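(* Let $k$ be a field of characteristic zero. As a graded ring, the Grothendieck ring $K(\mathsf{A}^{\boxtimes\infty})$ is isomorphic to the ring of formal power series (with integer coefficients) of bounded total degree in countably many variables $x_1,x_2,\dots$, graded by total degree; that is, $K(\mathsf{A}^{\boxtimes\infty}) \cong \bigoplus_{m\in\mathbb{N}} \mathbb{Z}[[x_1,x_2,\dots]]_m$.
   Context: A 2-rig is a symmetric monoidal $k$-linear category (tensor product $k$-bilinear on morphisms) that is Cauchy complete: it has finite biproducts, including a zero object, and all idempotents split. For a 2-rig $\mathsf{R}$, $K(\mathsf{R})$ is the group completion of the commutative monoid of isomorphism classes of objects under $\oplus$, with multiplication induced by $\otimes$. For a graded 2-rig $\mathsf{R}\simeq\bigoplus_m\mathsf{R}_m$ (coproduct of Cauchy complete $k$-linear categories, with $\otimes$ sending $\mathsf{R}_m,\mathsf{R}_n$ into $\mathsf{R}_{m+n}$ and unit in $\mathsf{R}_0$), $K(\mathsf{R})$ is graded with $m$th grade $K(\mathsf{R}_m)$. $\mathbb{Z}[[x_1,x_2,\dots]]_m$ is the group of all formal, possibly infinite, $\mathbb{Z}$-linear combinations of monomials of total degree $m$ in the variables $x_1,x_2,\dots$. $\mathsf{A}^{\boxtimes\infty}$: For $N\in\mathbb{N}$ let $\mathsf{A}^{\boxtimes N}$ be the 2-rig of $\mathbb{N}^N$-graded $k$-vector spaces of finite total dimension, with the usual graded tensor product and unsigned symmetry, graded so that its $m$th grade consists of the objects supported on $N$-tuples with sum $m$. Let $\phi_N\colon \mathsf{A}^{\boxtimes (N+1)}\to\mathsf{A}^{\boxtimes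 N}$ be the graded 2-rig map $\phi_N(V)_{(m_1,\dots,m_N)} = V_{(m_1,\dots,m_N,0)}$. $\mathsf{A}^{\boxtimes\infty}$ is the strict limit, taken in graded 2-rigs, of the diagram $\cdots \to \mathsf{A}^{\boxtimes (N+1)} \xrightarrow{\phi_N} \mathsf{A}^{\boxtimes N}\to\cdots\to \mathsf{A}^{\boxtimes 0}$. Explicitly, let $\mathbb{N}^{(\infty)}(m)$ be the set of sequences $(m_1,m_2,\dots)$ of natural numbers with sum $m$. The $m$th grade of $\mathsf{A}^{\boxtimes\infty}$ is the category $[\mathbb{N}^{(\infty)}(m),\mathsf{FinVect}]$ of families of finite-dimensional $k$-vector spaces indexed by the set $\mathbb{N}^{(\infty)}(m)$, and $\mathsf{A}^{\boxtimes\infty}$ is the coproduct, as Cauchy complete $k$-linear categories, of these grades over $m\in\mathbb{N}$ (each object has only finitely many nonzero homogeneous components, and maps preserve grades). The tensor product is $(V\otimes W)_a=\bigoplus_{b+c=a}V_b\otimes W_c$ (a finite sum), with the unsigned symmetry. *)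

theory Defs
  imports
    "Jordan_Normal_Form.Missing_VectorSpace"
    "HOL-Algebra.QuotRing"
    "HOL-Library.Poly_Mapping"
begin

section \<open>2-rigs and their Grothendieck rings\<close>

text \<open>
  The data of a 2-rig over \<open>k\<close>: a symmetric monoidal \<open>k\<close>-linear category. Morphisms are not tagged
  with their source and target, so all operations on morphisms take the objects as arguments.
  Each \<^term>\<open>Hom R x y\<close> is a \<open>k\<close>-module (its \<open>mult\<close> and \<open>one\<close> fields are irrelevant).
  \<open>Cmp R x y z g f\<close> is the composite of \<open>f : x \<rightarrow> y\<close> and \<open>g : y \<rightarrow> z\<close>;
  \<open>TensM R x x' y y' f g\<close> is \<open>f \<otimes> g : x \<otimes> y \<rightarrow> x' \<otimes> y'\<close> for \<open>f : x \<rightarrow> x'\<close> and \<open>g : y \<rightarrow> y'\<close>;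
  the associator is \<open>(x \<otimes> y) \<otimes> z \<rightarrow> x \<otimes> (y \<otimes> z)\<close>, the unitors are \<open>I \<otimes> x \<rightarrow> x\<close> and \<open>x \<otimes> I \<rightarrow> x\<close>,
  and the symmetry is \<open>x \<otimes> y \<rightarrow> y \<otimes> x\<close>. The definition of the Grothendieck ring below makes sense for
  bare data and uses no axioms.
\<close>

record ('k, 'o, 'm) two_rig_data =
  Obj :: "'o set"
  Hom :: "'o \<Rightarrow> 'o \<Rightarrow> ('k, 'm) module"
  Idn :: "'o \<Rightarrow> 'm"
  Cmp :: "'o \<Rightarrow> 'o \<Rightarrow> 'o \<Rightarrow> 'm \<Rightarrow> 'm \<Rightarrow> 'm"
  Tens :: "'o \<Rightarrow> 'o \<Rightarrow> 'o"
  TensM :: "'o \<Rightarrow> 'o \<Rightarrow> 'o \<Rightarrow> 'o \<Rightarrow> 'm \<Rightarrow> 'm \<Rightarrow> 'm"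
  UnitO :: "'o"
  Assoc :: "'o \<Rightarrow> 'o \<Rightarrow> 'o \<Rightarrow> 'm"
  LUnit :: "'o \<Rightarrow> 'm"
  RUnit :: "'o \<Rightarrow> 'm"
  Symm :: "'o \<Rightarrow> 'o \<Rightarrow> 'm"

text \<open>\<open>Grade R m\<close> is the set of objects of the full subcategory \<open>R\<^sub>m\<close>.\<close>

record ('k, 'o, 'm) graded_two_rig_data = "('k, 'o, 'm) two_rig_data" +
  Grade :: "nat \<Rightarrow> 'o set"

definition iso_obj :: "('k, 'o, 'm, 'e) two_rig_data_scheme \<Rightarrow> 'o \<Rightarrow> 'o \<Rightarrow> bool" where
  "iso_obj R x y \<longleftrightarrow> (\<exists>f \<in> carrier (Hom R x y). \<exists>g \<in> carrier (Hom R y x).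
     Cmp R x y x g f = Idn R x \<and> Cmp R y x y f g = Idn R y)"

definition is_zero_obj :: "('k, 'o, 'm, 'e) two_rig_data_scheme \<Rightarrow> 'o \<Rightarrow> bool" where
  "is_zero_obj R z \<longleftrightarrow> Idn R z = \<zero>\<^bsub>Hom R z z\<^esub>"

definition is_biproduct :: "('k, 'o, 'm, 'e) two_rig_data_scheme \<Rightarrow> 'o \<Rightarrow> 'o \<Rightarrow> 'o \<Rightarrow> bool" where
  "is_biproduct R x y z \<longleftrightarrow>
     (\<exists>i \<in> carrier (Hom R x z). \<exists>j \<in> carrier (Hom R y z).
      \<exists>p \<in> carrier (Hom R z x). \<exists>q \<in> carrier (Hom R z y).
        Cmp R x z x p i = Idn R x \<and> Cmp R y z y q j = Idn R y \<and>
        Cmp R y z x p j = \<zero>\<^bsub>Hom R y x\<^esub> \<and> Cmp R x z y q i = \<zero>\<^bsub>Hom R x y\<^esub> \<and>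
        Cmp R z x z i p \<oplus>\<^bsub>Hom R z z\<^esub> Cmp R z y z j q = Idn R z)"

definition iso_class :: "('k, 'o, 'm, 'e) two_rig_data_scheme \<Rightarrow> 'o \<Rightarrow> 'o set" where
  "iso_class R x = {y \<in> Obj R. iso_obj R x y}"

text \<open>The semiring of isomorphism classes of objects, with \<open>\<oplus>\<close> as addition and \<open>\<otimes>\<close> as multiplication.\<close>

definition iso_semiring :: "('k, 'o, 'm, 'e) two_rig_data_scheme \<Rightarrow> 'o set ring" where
  "iso_semiring R =
     \<lparr>carrier = iso_class R ` Obj R,
      mult = (\<lambda>X Y. {z \<in> Obj R. \<exists>x \<in> X. \<exists>y \<in> Y. iso_obj R (Tens R x y) z}),
      one = iso_class R (UnitO R),
      zero = {z \<in> Obj R. is_zero_obj R z},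
      add = (\<lambda>X Y. {z \<in> Obj R. \<exists>x \<in> X. \<exists>y \<in> Y. is_biproduct R x y z})\<rparr>"

text \<open>
  Group completion of (the additive monoid of) a commutative semiring; the pair \<open>(a, b)\<close> represents
  \<open>a - b\<close>. The additive monoid need not be cancellative, hence the summand \<open>e\<close>.
\<close>

definition completion_rel :: "('s, 'e) ring_scheme \<Rightarrow> (('s \<times> 's) \<times> ('s \<times> 's)) set" where
  "completion_rel S = {((a, b), (c, d)). a \<in> carrier S \<and> b \<in> carrier S \<and> c \<in> carrier S \<and> d \<in> carrier S \<and>
     (\<exists>e \<in> carrier S. a \<oplus>\<^bsub>S\<^esub> d \<oplus>\<^bsub>S\<^esub> e = c \<oplus>\<^bsub>S\<^esub> b \<oplus>\<^bsub>S\<^esub> e)}"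

definition diff_class :: "('s, 'e) ring_scheme \<Rightarrow> 's \<Rightarrow> 's \<Rightarrow> ('s \<times> 's) set" where
  "diff_class S a b = completion_rel S `` {(a, b)}"

definition group_completion :: "('s, 'e) ring_scheme \<Rightarrow> ('s \<times> 's) set ring" where
  "group_completion S =
     \<lparr>carrier = (carrier S \<times> carrier S) // completion_rel S,
      mult = (\<lambda>P Q. \<Union>(a, b) \<in> P. \<Union>(c, d) \<in> Q.
                diff_class S (a \<otimes>\<^bsub>S\<^esub> c \<oplus>\<^bsub>S\<^esub> b \<otimes>\<^bsub>S\<^esub> d) (a \<otimes>\<^bsub>S\<^esub> d \<oplus>\<^bsub>S\<^esub> b \<otimes>\<^bsub>S\<^esub> c)),
      one = diff_class S \<one>\<^bsub>S\<^esub> \<zero>\<^bsub>S\<^esub>,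
      zero = diff_class S \<zero>\<^bsub>S\<^esub> \<zero>\<^bsub>S\<^esub>,
      add = (\<lambda>P Q. \<Union>(a, b) \<in> P. \<Union>(c, d) \<in> Q. diff_class S (a \<oplus>\<^bsub>S\<^esub> c) (b \<oplus>\<^bsub>S\<^esub> d))\<rparr>"

definition groth_ring :: "('k, 'o, 'm, 'e) two_rig_data_scheme \<Rightarrow> ('o set \<times> 'o set) set ring" where
  "groth_ring R = group_completion (iso_semiring R)"

text \<open>The image of \<open>K(R\<^sub>m)\<close> in \<open>K(R)\<close>: all differences of classes of objects of \<open>R\<^sub>m\<close>.\<close>

definition groth_grade ::
    "('k, 'o, 'm, 'e) graded_two_rig_data_scheme \<Rightarrow> nat \<Rightarrow> ('o set \<times> 'o set) set set" where
  "groth_grade R m =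
     {diff_class (iso_semiring R) (iso_class R x) (iso_class R y) | x y. x \<in> Grade R m \<and> y \<in> Grade R m}"

section \<open>Finite-dimensional vector spaces\<close>

text \<open>
  Vectors are taken from the type \<^typ>\<open>nat \<Rightarrow> 'a\<close>, where \<^typ>\<open>'a\<close> is the type of scalars. A vector space
  here is an arbitrary vector space structure on an arbitrary subset of this type. As \<open>k\<^sup>n\<close> has a copy
  in this type for all \<open>n\<close>, the finite-dimensional ones form a category equivalent to that of all
  finite-dimensional \<open>k\<close>-vector spaces, and direct sums and tensor products exist in it.
\<close>

type_synonym 'a vs = "('a, nat \<Rightarrow> 'a) module"

definition fin_vect :: "('a, 'b) ring_scheme \<Rightarrow> 'a vs set" where
  "fin_vect k = {V. vectorspace k V \<and> vectorspace.fin_dim k V}"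

definition lin :: "('a, 'b) ring_scheme \<Rightarrow> 'a vs \<Rightarrow> 'a vs \<Rightarrow> ((nat \<Rightarrow> 'a) \<Rightarrow> (nat \<Rightarrow> 'a)) set" where
  "lin k V W = {f \<in> extensional (carrier V). linear_map k V W f}"

definition coord_space :: "('a, 'b) ring_scheme \<Rightarrow> nat \<Rightarrow> 'a vs" where
  "coord_space k n =
     \<lparr>carrier = {v. (\<forall>i<n. v i \<in> carrier k) \<and> (\<forall>i\<ge>n. v i = \<zero>\<^bsub>k\<^esub>)},
      mult = undefined, one = undefined,
      zero = (\<lambda>_. \<zero>\<^bsub>k\<^esub>),
      add = (\<lambda>u v i. u i \<oplus>\<^bsub>k\<^esub> v i),
      smult = (\<lambda>c v i. c \<otimes>\<^bsub>k\<^esub> v i)\<rparr>"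

definition bilinear ::
    "('a, 'b) ring_scheme \<Rightarrow> 'a vs \<Rightarrow> 'a vs \<Rightarrow> 'a vs \<Rightarrow> ((nat \<Rightarrow> 'a) \<Rightarrow> (nat \<Rightarrow> 'a) \<Rightarrow> (nat \<Rightarrow> 'a)) \<Rightarrow> bool" where
  "bilinear k V W X \<beta> \<longleftrightarrow>
     (\<forall>w \<in> carrier W. linear_map k V X (\<lambda>v. \<beta> v w)) \<and> (\<forall>v \<in> carrier V. linear_map k W X (\<beta> v))"

definition is_tensor ::
    "('a, 'b) ring_scheme \<Rightarrow> 'a vs \<Rightarrow> 'a vs \<Rightarrow> 'a vs \<Rightarrow> ((nat \<Rightarrow> 'a) \<Rightarrow> (nat \<Rightarrow> 'a) \<Rightarrow> (nat \<Rightarrow> 'a)) \<Rightarrow> bool" where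
  "is_tensor k V W T t \<longleftrightarrow> T \<in> fin_vect k \<and> bilinear k V W T t \<and>
     (\<forall>X \<beta>. bilinear k V W X \<beta> \<longrightarrow>
        (\<exists>!h. h \<in> lin k T X \<and> (\<forall>v \<in> carrier V. \<forall>w \<in> carrier W. h (t v w) = \<beta> v w)))"

definition tensor :: "('a, 'b) ring_scheme \<Rightarrow> 'a vs \<Rightarrow> 'a vs \<Rightarrow>
    'a vs \<times> ((nat \<Rightarrow> 'a) \<Rightarrow> (nat \<Rightarrow> 'a) \<Rightarrow> (nat \<Rightarrow> 'a))" where
  "tensor k V W = (SOME p. is_tensor k V W (fst p) (snd p))"

definition is_dsum ::
    "('a, 'b) ring_scheme \<Rightarrow> 'i set \<Rightarrow> ('i \<Rightarrow> 'a vs) \<Rightarrow> 'a vs \<Rightarrow> ('i \<Rightarrow> (nat \<Rightarrow> 'a) \<Rightarrow> (nat \<Rightarrow> 'a)) \<Rightarrow> bool" where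
  "is_dsum k I F S \<iota> \<longleftrightarrow> S \<in> fin_vect k \<and> (\<forall>i \<in> I. linear_map k (F i) S (\<iota> i)) \<and>
     bij_betw (\<lambda>x. \<Oplus>\<^bsub>S\<^esub>i\<in>I. \<iota> i (x i)) (\<Pi>\<^sub>E i\<in>I. carrier (F i)) (carrier S)"

definition dsum :: "('a, 'b) ring_scheme \<Rightarrow> 'i set \<Rightarrow> ('i \<Rightarrow> 'a vs) \<Rightarrow>
    'a vs \<times> ('i \<Rightarrow> (nat \<Rightarrow> 'a) \<Rightarrow> (nat \<Rightarrow> 'a))" where
  "dsum k I F = (SOME p. is_dsum k I F (fst p) (snd p))"

section \<open>The graded 2-rig of bounded-degree families of vector spaces\<close>

text \<open>
  A sequence of natural numbers with finite sum is an element of \<^typ>\<open>nat \<Rightarrow>\<^sub>0 nat\<close>; \<open>total\<close> is its sum.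
  The same type serves as the type of monomials in countably many variables. Positions are counted
  from 0, so position \<open>i\<close> corresponds to the variable \<open>x\<^sub>i\<^sub>+\<^sub>1\<close>.
\<close>

type_synonym index = "nat \<Rightarrow>\<^sub>0 nat"

definition total :: "index \<Rightarrow> nat" where
  "total a = (\<Sum>i \<in> Poly_Mapping.keys a. Poly_Mapping.lookup a i)"

definition splits :: "index \<Rightarrow> (index \<times> index) set" where
  "splits a = {(b, c). b + c = a}"

type_synonym 'a fam = "index \<Rightarrow> 'a vs"
type_synonym 'a fam_map = "index \<Rightarrow> (nat \<Rightarrow> 'a) \<Rightarrow> (nat \<Rightarrow> 'a)"

text \<open>
  An object of the coproduct of the grades is a finite family of homogeneous objects, that is, a
  family over all indices which vanishes in all but finitely many degrees.
\<close>

definition fam_obj :: "('a, 'b) ring_scheme \<Rightarrow> 'a fam set" where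
  "fam_obj k = {V. (\<forall>a. V a \<in> fin_vect k) \<and> (\<exists>d. \<forall>a. total a > d \<longrightarrow> carrier (V a) = {\<zero>\<^bsub>V a\<^esub>})}"

definition fam_grade :: "('a, 'b) ring_scheme \<Rightarrow> nat \<Rightarrow> 'a fam set" where
  "fam_grade k m = {V \<in> fam_obj k. \<forall>a. total a \<noteq> m \<longrightarrow> carrier (V a) = {\<zero>\<^bsub>V a\<^esub>}}"

definition fam_hom :: "('a, 'b) ring_scheme \<Rightarrow> 'a fam \<Rightarrow> 'a fam \<Rightarrow> ('a, 'a fam_map) module" where
  "fam_hom k V W =
     \<lparr>carrier = {f. \<forall>a. f a \<in> lin k (V a) (W a)},
      mult = undefined, one = undefined,
      zero = (\<lambda>a. \<lambda>v\<in>carrier (V a). \<zero>\<^bsub>W a\<^esub>),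
      add = (\<lambda>f g a. \<lambda>v\<in>carrier (V a). f a v \<oplus>\<^bsub>W a\<^esub> g a v),
      smult = (\<lambda>c f a. \<lambda>v\<in>carrier (V a). c \<odot>\<^bsub>W a\<^esub> f a v)\<rparr>"

definition fam_id :: "'a fam \<Rightarrow> 'a fam_map" where
  "fam_id V = (\<lambda>a. \<lambda>v\<in>carrier (V a). v)"

definition fam_comp :: "'a fam \<Rightarrow> 'a fam_map \<Rightarrow> 'a fam_map \<Rightarrow> 'a fam_map" where
  "fam_comp V g f = (\<lambda>a. compose (carrier (V a)) (g a) (f a))"

definition tens_dsum :: "('a, 'b) ring_scheme \<Rightarrow> 'a fam \<Rightarrow> 'a fam \<Rightarrow> index \<Rightarrow>
    'a vs \<times> (index \<times> index \<Rightarrow> (nat \<Rightarrow> 'a) \<Rightarrow> (nat \<Rightarrow> 'a))" where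
  "tens_dsum k V W a = dsum k (splits a) (\<lambda>(b, c). fst (tensor k (V b) (W c)))"

definition fam_tens :: "('a, 'b) ring_scheme \<Rightarrow> 'a fam \<Rightarrow> 'a fam \<Rightarrow> 'a fam" where
  "fam_tens k V W = (\<lambda>a. fst (tens_dsum k V W a))"

text \<open>
  The vector \<open>v \<otimes> w\<close> of \<open>(V \<otimes> W)\<^bsub>b+c\<^esub>\<close> for \<open>v \<in> V\<^sub>b\<close> and \<open>w \<in> W\<^sub>c\<close>. These vectors generate \<open>V \<otimes> W\<close>, so
  that the structural morphisms below are uniquely determined by their values on them.
\<close>

definition pure :: "('a, 'b) ring_scheme \<Rightarrow> 'a fam \<Rightarrow> 'a fam \<Rightarrow> index \<Rightarrow> index \<Rightarrow>
    (nat \<Rightarrow> 'a) \<Rightarrow> (nat \<Rightarrow> 'a) \<Rightarrow> (nat \<Rightarrow> 'a)" where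
  "pure k V W b c v w = snd (tens_dsum k V W (b + c)) (b, c) (snd (tensor k (V b) (W c)) v w)"

definition fam_tens_map :: "('a, 'b) ring_scheme \<Rightarrow> 'a fam \<Rightarrow> 'a fam \<Rightarrow> 'a fam \<Rightarrow> 'a fam \<Rightarrow>
    'a fam_map \<Rightarrow> 'a fam_map \<Rightarrow> 'a fam_map" where
  "fam_tens_map k V V' W W' f g =
     (THE h. h \<in> carrier (fam_hom k (fam_tens k V W) (fam_tens k V' W')) \<and>
        (\<forall>b c. \<forall>v \<in> carrier (V b). \<forall>w \<in> carrier (W c).
           h (b + c) (pure k V W b c v w) = pure k V' W' b c (f b v) (g c w)))"

definition fam_unit :: "('a, 'b) ring_scheme \<Rightarrow> 'a fam" where
  "fam_unit k = (\<lambda>a. coord_space k (if a = 0 then 1 else 0))"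

definition fam_assoc :: "('a, 'b) ring_scheme \<Rightarrow> 'a fam \<Rightarrow> 'a fam \<Rightarrow> 'a fam \<Rightarrow> 'a fam_map" where
  "fam_assoc k U V W =
     (THE h. h \<in> carrier (fam_hom k (fam_tens k (fam_tens k U V) W) (fam_tens k U (fam_tens k V W))) \<and>
        (\<forall>a b c. \<forall>u \<in> carrier (U a). \<forall>v \<in> carrier (V b). \<forall>w \<in> carrier (W c).
           h (a + b + c) (pure k (fam_tens k U V) W (a + b) c (pure k U V a b u v) w) =
           pure k U (fam_tens k V W) a (b + c) u (pure k V W b c v w)))"

definition fam_lunit :: "('a, 'b) ring_scheme \<Rightarrow> 'a fam \<Rightarrow> 'a fam_map" where
  "fam_lunit k V =
     (THE h. h \<in> carrier (fam_hom k (fam_tens k (fam_unit k) V) V) \<and>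
        (\<forall>a. \<forall>x \<in> carrier (fam_unit k 0). \<forall>v \<in> carrier (V a).
           h a (pure k (fam_unit k) V 0 a x v) = x 0 \<odot>\<^bsub>V a\<^esub> v))"

definition fam_runit :: "('a, 'b) ring_scheme \<Rightarrow> 'a fam \<Rightarrow> 'a fam_map" where
  "fam_runit k V =
     (THE h. h \<in> carrier (fam_hom k (fam_tens k V (fam_unit k)) V) \<and>
        (\<forall>a. \<forall>x \<in> carrier (fam_unit k 0). \<forall>v \<in> carrier (V a).
           h a (pure k V (fam_unit k) a 0 v x) = x 0 \<odot>\<^bsub>V a\<^esub> v))"

definition fam_symm :: "('a, 'b) ring_scheme \<Rightarrow> 'a fam \<Rightarrow> 'a fam \<Rightarrow> 'a fam_map" where
  "fam_symm k V W =
     (THE h. h \<in> carrier (fam_hom k (fam_tens k V W) (fam_tens k W V)) \<and>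
        (\<forall>b c. \<forall>v \<in> carrier (V b). \<forall>w \<in> carrier (W c).
           h (b + c) (pure k V W b c v w) = pure k W V c b w v))"

definition A_inf :: "('a, 'b) ring_scheme \<Rightarrow> ('a, 'a fam, 'a fam_map) graded_two_rig_data" where
  "A_inf k =
     \<lparr>Obj = fam_obj k,
      Hom = fam_hom k,
      Idn = fam_id,
      Cmp = (\<lambda>U V W. fam_comp U),
      Tens = fam_tens k,
      TensM = fam_tens_map k,
      UnitO = fam_unit k,
      Assoc = fam_assoc k,
      LUnit = fam_lunit k,
      RUnit = fam_runit k,
      Symm = fam_symm k,
      Grade = fam_grade k\<rparr>"

section \<open>Graded rings and power series of bounded degree\<close>

locale graded_ring = ring R for R (structure) +
  fixes G :: "nat \<Rightarrow> 'a set"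
  assumes grade_subgroup: "additive_subgroup (G m) R"
    and grade_one: "\<one> \<in> G 0"
    and grade_mult: "\<lbrakk>x \<in> G m; y \<in> G n\<rbrakk> \<Longrightarrow> x \<otimes> y \<in> G (m + n)"
    and grade_decomp: "x \<in> carrier R \<Longrightarrow>
      \<exists>!f. (\<forall>m. f m \<in> G m) \<and> finite {m. f m \<noteq> \<zero>} \<and> x = (\<Oplus>m\<in>{m. f m \<noteq> \<zero>}. f m)"

definition graded_ring_iso ::
    "('r, 'e) ring_scheme \<Rightarrow> (nat \<Rightarrow> 'r set) \<Rightarrow> ('s, 'f) ring_scheme \<Rightarrow> (nat \<Rightarrow> 's set) \<Rightarrow> ('r \<Rightarrow> 's) set" where
  "graded_ring_iso R G S H = {h \<in> ring_iso R S. \<forall>m. h ` G m = H m}"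

definition bounded_series_ring :: "(index \<Rightarrow> int) ring" where
  "bounded_series_ring =
     \<lparr>carrier = {f. \<exists>d. \<forall>a. f a \<noteq> 0 \<longrightarrow> total a \<le> d},
      mult = (\<lambda>f g a. \<Sum>(b, c) \<in> splits a. f b * g c),
      one = (\<lambda>a. if a = 0 then 1 else 0),
      zero = (\<lambda>a. 0),
      add = (\<lambda>f g a. f a + g a)\<rparr>"

definition homogeneous_series :: "nat \<Rightarrow> (index \<Rightarrow> int) set" where
  "homogeneous_series m = {f. \<forall>a. f a \<noteq> 0 \<longrightarrow> total a = m}"

end

theory Submission
  imports Defs "HOL-Algebra.UnivPoly"
begin

text \<open>
  A finite-dimensional vector space is determined up to isomorphism by its dimension, and dimensions
  add on biproducts and multiply on tensor products. Hence a bounded-degree family \<open>V\<close> is determined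
  up to isomorphism by the function \<open>a \<mapsto> dim V\<^sub>a\<close>, every nonnegative integer series of bounded degree
  arises in this way, biproducts become sums and tensor products become Cauchy products. So the
  isomorphism classes form the subsemiring of nonnegative series in the ring of series of bounded
  degree. As every series is a difference of two nonnegative ones, that ring is the group completion.
\<close>

section \<open>Linear maps and bases\<close>

text \<open>Linear algebra enters only through \<open>frame\<close>, a basis given as a finite
  indexed family. Indexing by an arbitrary finite set makes the dimension formulas counting
  statements: a direct sum has a basis indexed by a \<open>Sigma\<close> set, a tensor product one
  indexed by a product. Direct sums and tensor products are chosen by \<open>SOME\<close> from a
  characterising property, so nothing beyond that property is known about them. An explicit model in
  a coordinate space shows that the choice is possible, and for tensor products uniqueness up to
  isomorphism carries the dimension over. Morphisms of families are arbitrary families of linear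
  maps, so isomorphisms and biproducts can be examined one index at a time. The data of
  \<open>iso_semiring\<close> come without any laws; what counts is the injection into a ring, which
  supplies cancellation. The ring axioms of the group completion are moved along a bijection with
  the series ring instead of being checked on classes of pairs: such a class is the set of all
  \<open>(a, b)\<close> whose dimension series have a given difference.\<close>

lemma linear_mapI:
  assumes "vectorspace K V" "vectorspace K W"
    and "\<And>v. v \<in> carrier V \<Longrightarrow> T v \<in> carrier W"
    and "\<And>v w. v \<in> carrier V \<Longrightarrow> w \<in> carrier V \<Longrightarrow> T (v \<oplus>\<^bsub>V\<^esub> w) = T v \<oplus>\<^bsub>W\<^esub> T w"
    and "\<And>c v. c \<in> carrier K \<Longrightarrow> v \<in> carrier V \<Longrightarrow> T (c \<odot>\<^bsub>V\<^esub> v) = c \<odot>\<^bsub>W\<^esub> T v"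
  shows "linear_map K V W T"
  using assms
  by (auto simp: linear_map_def vectorspace_def mod_hom_def mod_hom_axioms_def module_hom_def)

lemma
  assumes "linear_map K V W T"
  shows linear_map_source: "vectorspace K V"
    and linear_map_target: "vectorspace K W"
    and linear_map_closed: "v \<in> carrier V \<Longrightarrow> T v \<in> carrier W"
    and linear_map_add: "v \<in> carrier V \<Longrightarrow> w \<in> carrier V \<Longrightarrow> T (v \<oplus>\<^bsub>V\<^esub> w) = T v \<oplus>\<^bsub>W\<^esub> T w"
    and linear_map_smult: "c \<in> carrier K \<Longrightarrow> v \<in> carrier V \<Longrightarrow> T (c \<odot>\<^bsub>V\<^esub> v) = c \<odot>\<^bsub>W\<^esub> T v"
    and linear_map_zero: "T \<zero>\<^bsub>V\<^esub> = \<zero>\<^bsub>W\<^esub>"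
proof -
  interpret linear_map K V W T by fact
  show "vectorspace K V" by (fact V.vectorspace_axioms)
  show "vectorspace K W" by (fact W.vectorspace_axioms)
  show "v \<in> carrier V \<Longrightarrow> T v \<in> carrier W" by simp
  show "v \<in> carrier V \<Longrightarrow> w \<in> carrier V \<Longrightarrow> T (v \<oplus>\<^bsub>V\<^esub> w) = T v \<oplus>\<^bsub>W\<^esub> T w" by simp
  show "c \<in> carrier K \<Longrightarrow> v \<in> carrier V \<Longrightarrow> T (c \<odot>\<^bsub>V\<^esub> v) = c \<odot>\<^bsub>W\<^esub> T v" by simp
  show "T \<zero>\<^bsub>V\<^esub> = \<zero>\<^bsub>W\<^esub>" by simp
qed

lemma linear_map_finsum:
  assumes T: "linear_map K V W T" and "finite I" "\<And>i. i \<in> I \<Longrightarrow> f i \<in> carrier V"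
  shows "T (\<Oplus>\<^bsub>V\<^esub>i\<in>I. f i) = (\<Oplus>\<^bsub>W\<^esub>i\<in>I. T (f i))"
proof -
  interpret V: vectorspace K V by (rule linear_map_source[OF T])
  interpret W: vectorspace K W by (rule linear_map_target[OF T])
  show ?thesis
    using assms(2,3)
  proof (induction I)
    case (insert i I)
    then have "f i \<in> carrier V" "f \<in> I \<rightarrow> carrier V" by auto
    with insert show ?case
      by (simp add: V.finsum_insert W.finsum_insert Pi_iff linear_map_add[OF T] linear_map_closed[OF T])
  qed (simp add: linear_map_zero[OF T])
qed

lemma (in vectorspace) linear_map_identity: "linear_map K V V (\<lambda>v. v)"
  by (intro linear_mapI vectorspace_axioms) auto

lemma linear_map_cong:
  assumes T: "linear_map K V W T" and eq: "\<And>v. v \<in> carrier V \<Longrightarrow> T v = T' v"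
  shows "linear_map K V W T'"
proof -
  interpret V: vectorspace K V by (rule linear_map_source[OF T])
  show ?thesis
    by (intro linear_mapI linear_map_source[OF T] linear_map_target[OF T])
      (auto simp: eq[symmetric] linear_map_closed[OF T] linear_map_add[OF T] linear_map_smult[OF T])
qed

lemma linear_map_comp:
  assumes S: "linear_map K U V S" and T: "linear_map K V W T"
  shows "linear_map K U W (\<lambda>u. T (S u))"
  by (intro linear_mapI linear_map_source[OF S] linear_map_target[OF T])
    (auto simp: linear_map_closed[OF T] linear_map_add[OF T] linear_map_smult[OF T]
      linear_map_closed[OF S] linear_map_add[OF S] linear_map_smult[OF S])

lemma linear_map_sum:
  assumes S: "linear_map K V W S" and T: "linear_map K V W T"
  shows "linear_map K V W (\<lambda>v. S v \<oplus>\<^bsub>W\<^esub> T v)"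
proof -
  interpret W: vectorspace K W by (rule linear_map_target[OF T])
  show ?thesis
    by (intro linear_mapI linear_map_source[OF T] linear_map_target[OF T])
      (auto simp: linear_map_closed[OF T] linear_map_add[OF T] linear_map_smult[OF T]
        linear_map_closed[OF S] linear_map_add[OF S] linear_map_smult[OF S]
        W.smult_r_distr W.a_ac)
qed

lemma linD:
  assumes "f \<in> lin k V W"
  shows "linear_map k V W f" "f \<in> extensional (carrier V)"
  using assms by (auto simp: lin_def)

text \<open>A basis as a family instead of a set of vectors: spanning and independence together say
  that taking linear combinations is bijective. Coefficient functions are extensional because
  arbitrary values off \<open>J\<close> would spoil injectivity.\<close>

locale frame = vectorspace K V for K and V +
  fixes J :: "'j set" and b
  assumes finite_J: "finite J"
    and b_closed: "j \<in> J \<Longrightarrow> b j \<in> carrier V"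
    and comb_bij: "bij_betw (\<lambda>u. \<Oplus>\<^bsub>V\<^esub>j\<in>J. u j \<odot>\<^bsub>V\<^esub> b j) (J \<rightarrow>\<^sub>E carrier K) (carrier V)"
begin

abbreviation comb where "comb u \<equiv> \<Oplus>\<^bsub>V\<^esub>j\<in>J. u j \<odot>\<^bsub>V\<^esub> b j"

definition coord where "coord = inv_into (J \<rightarrow>\<^sub>E carrier K) (\<lambda>u. comb u)"

lemma coord_PiE: "v \<in> carrier V \<Longrightarrow> coord v \<in> J \<rightarrow>\<^sub>E carrier K"
  unfolding coord_def by (rule bij_betw_apply[OF bij_betw_inv_into[OF comb_bij]])

lemma coord_closed [simp]: "v \<in> carrier V \<Longrightarrow> j \<in> J \<Longrightarrow> coord v j \<in> carrier K"
  using coord_PiE by auto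

lemma comb_coord [simp]: "v \<in> carrier V \<Longrightarrow> comb (coord v) = v"
  unfolding coord_def by (rule bij_betw_inv_into_right[OF comb_bij])

lemma comb_cong: "(\<And>j. j \<in> J \<Longrightarrow> u j = u' j) \<Longrightarrow> (\<And>j. j \<in> J \<Longrightarrow> u' j \<in> carrier K) \<Longrightarrow> comb u = comb u'"
  by (rule finsum_cong') (auto simp: b_closed)

lemma coord_comb:
  assumes "\<And>j. j \<in> J \<Longrightarrow> u j \<in> carrier K" "j \<in> J"
  shows "coord (comb u) j = u j"
proof -
  \<comment> \<open>\<open>coord\<close> inverts linear combination on extensional functions only,
    hence the detour through \<open>restrict u J\<close>.\<close>
  have "coord (comb (restrict u J)) = restrict u J"
    unfolding coord_def by (rule bij_betw_inv_into_left[OF comb_bij]) (use assms in auto)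
  moreover have "comb (restrict u J) = comb u"
    by (rule comb_cong) (use assms in auto)
  ultimately show ?thesis using assms by simp
qed

lemma comb_closed [simp]: "(\<And>j. j \<in> J \<Longrightarrow> u j \<in> carrier K) \<Longrightarrow> comb u \<in> carrier V"
  by (auto intro!: finsum_closed simp: b_closed)

lemma coord_unique:
  assumes "\<And>j. j \<in> J \<Longrightarrow> u j \<in> carrier K" "comb u = v" "j \<in> J"
  shows "coord v j = u j"
  using coord_comb[of u j] assms by simp

lemma comb_add:
  assumes "\<And>j. j \<in> J \<Longrightarrow> u j \<in> carrier K" "\<And>j. j \<in> J \<Longrightarrow> w j \<in> carrier K"
  shows "comb (\<lambda>j. u j \<oplus>\<^bsub>K\<^esub> w j) = comb u \<oplus>\<^bsub>V\<^esub> comb w"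
proof -
  have "comb (\<lambda>j. u j \<oplus>\<^bsub>K\<^esub> w j) = (\<Oplus>\<^bsub>V\<^esub>j\<in>J. u j \<odot>\<^bsub>V\<^esub> b j \<oplus>\<^bsub>V\<^esub> w j \<odot>\<^bsub>V\<^esub> b j)"
    by (rule finsum_cong') (use assms in \<open>auto simp: b_closed smult_l_distr\<close>)
  also have "\<dots> = comb u \<oplus>\<^bsub>V\<^esub> comb w"
    by (rule finsum_addf) (use assms in \<open>auto simp: b_closed\<close>)
  finally show ?thesis .
qed

lemma comb_smult:
  assumes "c \<in> carrier K" "\<And>j. j \<in> J \<Longrightarrow> u j \<in> carrier K"
  shows "comb (\<lambda>j. c \<otimes>\<^bsub>K\<^esub> u j) = c \<odot>\<^bsub>V\<^esub> comb u"
proof -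
  have "comb (\<lambda>j. c \<otimes>\<^bsub>K\<^esub> u j) = (\<Oplus>\<^bsub>V\<^esub>j\<in>J. c \<odot>\<^bsub>V\<^esub> (u j \<odot>\<^bsub>V\<^esub> b j))"
    by (rule finsum_cong') (use assms in \<open>auto simp: b_closed smult_assoc1\<close>)
  also have "\<dots> = c \<odot>\<^bsub>V\<^esub> comb u"
    by (rule finsum_smult[symmetric]) (use assms in \<open>auto simp: b_closed\<close>)
  finally show ?thesis .
qed

lemma comb_delta:
  assumes "i \<in> J"
  shows "comb (\<lambda>j. if j = i then \<one>\<^bsub>K\<^esub> else \<zero>\<^bsub>K\<^esub>) = b i"
proof -
  have "comb (\<lambda>j. if j = i then \<one>\<^bsub>K\<^esub> else \<zero>\<^bsub>K\<^esub>) = (\<Oplus>\<^bsub>V\<^esub>j\<in>J. if i = j then b j else \<zero>\<^bsub>V\<^esub>)"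
    by (rule finsum_cong') (auto simp: b_closed)
  also have "\<dots> = b i"
    using assms finite_J by (intro finsum_singleton) (auto simp: b_closed)
  finally show ?thesis .
qed

lemma coord_add:
  assumes "v \<in> carrier V" "w \<in> carrier V" "j \<in> J"
  shows "coord (v \<oplus>\<^bsub>V\<^esub> w) j = coord v j \<oplus>\<^bsub>K\<^esub> coord w j"
  by (rule coord_unique) (use assms comb_add[of "coord v" "coord w"] in auto)

lemma coord_smult:
  assumes "c \<in> carrier K" "v \<in> carrier V" "j \<in> J"
  shows "coord (c \<odot>\<^bsub>V\<^esub> v) j = c \<otimes>\<^bsub>K\<^esub> coord v j"
  by (rule coord_unique) (use assms comb_smult[of c "coord v"] in auto)

lemma coord_b:
  assumes "i \<in> J" "j \<in> J"
  shows "coord (b i) j = (if j = i then \<one>\<^bsub>K\<^esub> else \<zero>\<^bsub>K\<^esub>)"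
  by (rule coord_unique) (use assms comb_delta in auto)

text \<open>If two indices had the same vector, its \<open>i\<close>-th coordinate would be both 1
  and 0, which differ in a field.\<close>

lemma b_inj: "inj_on b J"
proof (rule inj_onI)
  fix i j assume *: "i \<in> J" "j \<in> J" "b i = b j"
  then have "coord (b i) i = coord (b j) i" by simp
  with * show "i = j" using coord_b[of i i] coord_b[of j i] by (auto split: if_splits)
qed

text \<open>Bridge to the library, where a basis is a set of vectors. As \<open>b\<close> is
  injective, a combination over its image can be reindexed over \<open>J\<close>, and unique
  coordinates carry over to the library's criterion.\<close>

lemma basis_b: "basis (b ` J)"
proof -
  have "\<exists>!a. a \<in> b ` J \<rightarrow>\<^sub>E carrier K \<and> lincomb a (b ` J) = v" if v: "v \<in> carrier V" for v
  proof -
    have lc: "lincomb a (b ` J) = comb (\<lambda>j. a (b j))" if "a \<in> b ` J \<rightarrow>\<^sub>E carrier K" for a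
    proof -
      have "a (b j) \<in> carrier K" if "j \<in> J" for j
        using that \<open>a \<in> b ` J \<rightarrow>\<^sub>E carrier K\<close> by auto
      then show ?thesis
        unfolding lincomb_def by (subst finsum_reindex) (use b_inj in \<open>auto simp: b_closed\<close>)
    qed
    show ?thesis
    proof (rule ex_ex1I)
      let ?a = "restrict (\<lambda>x. coord v (inv_into J b x)) (b ` J)"
      have "?a \<in> b ` J \<rightarrow>\<^sub>E carrier K"
        using v by (auto simp: b_inj)
      moreover from this have "lincomb ?a (b ` J) = v"
        by (subst lc, simp) (use v b_inj comb_cong[of "\<lambda>j. ?a (b j)" "coord v"] in simp)
      ultimately show "\<exists>a. a \<in> b ` J \<rightarrow>\<^sub>E carrier K \<and> lincomb a (b ` J) = v" by blast
    next
      fix a a'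
      assume "a \<in> b ` J \<rightarrow>\<^sub>E carrier K \<and> lincomb a (b ` J) = v"
        and "a' \<in> b ` J \<rightarrow>\<^sub>E carrier K \<and> lincomb a' (b ` J) = v"
      then have *: "a \<in> b ` J \<rightarrow>\<^sub>E carrier K" "a' \<in> b ` J \<rightarrow>\<^sub>E carrier K"
        "comb (\<lambda>j. a (b j)) = v" "comb (\<lambda>j. a' (b j)) = v" using lc by auto
      have "a (b j) = a' (b j)" if "j \<in> J" for j
        using coord_unique[OF _ *(3) that] coord_unique[OF _ *(4) that] *(1,2)
        by (metis PiE_mem imageI)
      then show "a = a'" using * by (intro PiE_ext) auto
    qed
  qed
  then show ?thesis
    using basis_criterion[of "b ` J"] finite_J b_closed by blast
qed

lemma dim_eq_card: "dim = card J"
  using dim_basis[OF _ basis_b] finite_J by (simp add: card_image[OF b_inj])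

lemma fin_dim: fin_dim
  using basis_b finite_J by (auto simp: fin_dim_def basis_def)

text \<open>The linear map with prescribed values \<open>c j\<close> on the basis vectors
  \<open>b j\<close>. Restriction to the carrier makes it extensional, as \<open>lin\<close>
  demands, so that maps agreeing on a basis are equal as functions.\<close>

definition extend :: "('a, 'w, 'f) module_scheme \<Rightarrow> ('j \<Rightarrow> 'w) \<Rightarrow> 'c \<Rightarrow> 'w" where
  "extend W c = (\<lambda>v\<in>carrier V. \<Oplus>\<^bsub>W\<^esub>j\<in>J. coord v j \<odot>\<^bsub>W\<^esub> c j)"

lemma
  assumes W: "vectorspace K W" and c: "\<And>j. j \<in> J \<Longrightarrow> c j \<in> carrier W"
  shows extend_linear: "linear_map K V W (extend W c)"
    and extend_b: "j \<in> J \<Longrightarrow> extend W c (b j) = c j"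
proof -
  interpret W: vectorspace K W by fact
  show "linear_map K V W (extend W c)"
  proof (rule linear_mapI[OF vectorspace_axioms W])
    fix v w assume *: "v \<in> carrier V" "w \<in> carrier V"
    then have "extend W c (v \<oplus>\<^bsub>V\<^esub> w) = (\<Oplus>\<^bsub>W\<^esub>j\<in>J. coord (v \<oplus>\<^bsub>V\<^esub> w) j \<odot>\<^bsub>W\<^esub> c j)"
      by (simp add: extend_def)
    also have "\<dots> = (\<Oplus>\<^bsub>W\<^esub>j\<in>J. coord v j \<odot>\<^bsub>W\<^esub> c j \<oplus>\<^bsub>W\<^esub> coord w j \<odot>\<^bsub>W\<^esub> c j)"
      by (rule W.finsum_cong') (use * c in \<open>auto simp: coord_add W.smult_l_distr\<close>)
    also have "\<dots> = (\<Oplus>\<^bsub>W\<^esub>j\<in>J. coord v j \<odot>\<^bsub>W\<^esub> c j) \<oplus>\<^bsub>W\<^esub> (\<Oplus>\<^bsub>W\<^esub>j\<in>J. coord w j \<odot>\<^bsub>W\<^esub> c j)"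
      by (rule W.finsum_addf) (use * c in auto)
    finally show "extend W c (v \<oplus>\<^bsub>V\<^esub> w) = extend W c v \<oplus>\<^bsub>W\<^esub> extend W c w"
      using * by (simp add: extend_def)
  next
    fix a v assume *: "a \<in> carrier K" "v \<in> carrier V"
    then have "extend W c (a \<odot>\<^bsub>V\<^esub> v) = (\<Oplus>\<^bsub>W\<^esub>j\<in>J. coord (a \<odot>\<^bsub>V\<^esub> v) j \<odot>\<^bsub>W\<^esub> c j)"
      by (simp add: extend_def)
    also have "\<dots> = (\<Oplus>\<^bsub>W\<^esub>j\<in>J. a \<odot>\<^bsub>W\<^esub> (coord v j \<odot>\<^bsub>W\<^esub> c j))"
      by (rule W.finsum_cong') (use * c in \<open>auto simp: coord_smult W.smult_assoc1\<close>)
    also have "\<dots> = a \<odot>\<^bsub>W\<^esub> (\<Oplus>\<^bsub>W\<^esub>j\<in>J. coord v j \<odot>\<^bsub>W\<^esub> c j)"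
      by (rule W.finsum_smult[symmetric]) (use * c in auto)
    finally show "extend W c (a \<odot>\<^bsub>V\<^esub> v) = a \<odot>\<^bsub>W\<^esub> extend W c v"
      using * by (simp add: extend_def)
  qed (use c in \<open>auto simp: extend_def intro!: W.finsum_closed\<close>)
  assume j: "j \<in> J"
  have "extend W c (b j) = (\<Oplus>\<^bsub>W\<^esub>i\<in>J. if j = i then c i else \<zero>\<^bsub>W\<^esub>)"
    using j c by (auto simp: extend_def b_closed coord_b intro!: W.finsum_cong')
  also have "\<dots> = c j"
    using j c finite_J by (intro W.finsum_singleton) auto
  finally show "extend W c (b j) = c j" .
qed

lemma extend_extensional: "extend W c \<in> extensional (carrier V)"
  by (simp add: extend_def)

lemma linear_eqI:
  assumes "linear_map K V W S" "linear_map K V W T"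
    and eq: "\<And>j. j \<in> J \<Longrightarrow> S (b j) = T (b j)" and v: "v \<in> carrier V"
  shows "S v = T v"
proof -
  interpret W: vectorspace K W by (rule linear_map_target[OF assms(1)])
  have "S (comb (coord v)) = (\<Oplus>\<^bsub>W\<^esub>j\<in>J. coord v j \<odot>\<^bsub>W\<^esub> S (b j))"
    if "linear_map K V W S" for S
    using v by (subst linear_map_finsum[OF that finite_J])
      (auto simp: b_closed linear_map_smult[OF that] linear_map_closed[OF that] intro!: W.finsum_cong')
  note sum = this
  have "(\<Oplus>\<^bsub>W\<^esub>j\<in>J. coord v j \<odot>\<^bsub>W\<^esub> S (b j)) = (\<Oplus>\<^bsub>W\<^esub>j\<in>J. coord v j \<odot>\<^bsub>W\<^esub> T (b j))"
    by (rule W.finsum_cong') (use v b_closed linear_map_closed[OF assms(2)] in \<open>auto simp: eq\<close>)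
  with sum[OF assms(1)] sum[OF assms(2)] v show ?thesis
    by simp
qed

text \<open>Substituting along \<open>e\<close> is a bijection between the two sets of coefficient
  functions and is compatible with linear combinations. It provides coordinate spaces with bases
  indexed by pairs.\<close>

lemma reindex:
  assumes e: "bij_betw e I J"
  shows "frame K V I (\<lambda>i. b (e i))"
proof
  show fin: "finite I" using e finite_J bij_betw_finite by blast
  show "b (e i) \<in> carrier V" if "i \<in> I" for i
    using e that b_closed bij_betwE by blast
  have *: "(\<Oplus>\<^bsub>V\<^esub>i\<in>I. u i \<odot>\<^bsub>V\<^esub> b (e i)) = comb (\<lambda>j\<in>J. u (inv_into I e j))"
    if "u \<in> I \<rightarrow>\<^sub>E carrier K" for u
  proof -
    have u: "u i \<in> carrier K" if "i \<in> I" for i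
      using that \<open>u \<in> I \<rightarrow>\<^sub>E carrier K\<close> by auto
    have "comb (\<lambda>j\<in>J. u (inv_into I e j)) = (\<Oplus>\<^bsub>V\<^esub>j\<in>e ` I. u (inv_into I e j) \<odot>\<^bsub>V\<^esub> b j)"
      using e that inv_into_into[of _ e I] by (intro finsum_cong') (auto simp: bij_betw_def b_closed u)
    also have "\<dots> = (\<Oplus>\<^bsub>V\<^esub>i\<in>I. u (inv_into I e (e i)) \<odot>\<^bsub>V\<^esub> b (e i))"
      using e that b_closed inv_into_into[of _ e I] by (intro finsum_reindex) (auto simp: bij_betw_def u)
    also have "\<dots> = (\<Oplus>\<^bsub>V\<^esub>i\<in>I. u i \<odot>\<^bsub>V\<^esub> b (e i))"
      using e that b_closed by (intro finsum_cong') (auto simp: bij_betw_def u)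
    finally show ?thesis by simp
  qed
  have "bij_betw (\<lambda>u. \<lambda>j\<in>J. u (inv_into I e j)) (I \<rightarrow>\<^sub>E carrier K) (J \<rightarrow>\<^sub>E carrier K)"
  proof (rule bij_betw_byWitness[where f' = "\<lambda>u. \<lambda>i\<in>I. u (e i)"])
    have e_inv: "inv_into I e (e i) = i" "e i \<in> J" if "i \<in> I" for i
      using e that by (auto simp: bij_betw_def)
    have inv_e: "e (inv_into I e j) = j" "inv_into I e j \<in> I" if "j \<in> J" for j
      using e that by (auto simp: bij_betw_def f_inv_into_f inv_into_into)
    show "\<forall>u\<in>I \<rightarrow>\<^sub>E carrier K. (\<lambda>i\<in>I. (\<lambda>j\<in>J. u (inv_into I e j)) (e i)) = u"
      by (auto intro!: PiE_ext[where k = I and s = "\<lambda>_. carrier K"] simp: e_inv)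
    show "\<forall>u\<in>J \<rightarrow>\<^sub>E carrier K. (\<lambda>j\<in>J. (\<lambda>i\<in>I. u (e i)) (inv_into I e j)) = u"
      by (auto intro!: PiE_ext[where k = J and s = "\<lambda>_. carrier K"] simp: inv_e)
    show "(\<lambda>u. \<lambda>j\<in>J. u (inv_into I e j)) ` (I \<rightarrow>\<^sub>E carrier K) \<subseteq> J \<rightarrow>\<^sub>E carrier K"
      using inv_e by auto
    show "(\<lambda>u. \<lambda>i\<in>I. u (e i)) ` (J \<rightarrow>\<^sub>E carrier K) \<subseteq> I \<rightarrow>\<^sub>E carrier K"
      using e_inv by auto
  qed
  from bij_betw_trans[OF this comb_bij]
  show "bij_betw (\<lambda>u. \<Oplus>\<^bsub>V\<^esub>i\<in>I. u i \<odot>\<^bsub>V\<^esub> b (e i)) (I \<rightarrow>\<^sub>E carrier K) (carrier V)"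
    by (rule iffD1[OF bij_betw_cong, rotated]) (simp add: *)
qed

end

text \<open>The index set depends on the dimension only, so two spaces of equal dimension get bases
  over the same set and can be matched vector by vector.\<close>

lemma (in vectorspace) frame_exists:
  assumes fin_dim
  obtains b where "frame K V {..<dim} b"
proof -
  obtain B where B: "finite B" "basis B"
    using finite_basis_exists[OF assms] by blast
  then have sub: "B \<subseteq> carrier V" by (simp add: basis_def)
  have ex1: "\<exists>!a. a \<in> B \<rightarrow>\<^sub>E carrier K \<and> lincomb a B = v" if "v \<in> carrier V" for v
    using basis_criterion[OF B(1) sub] B(2) that by blast
  \<comment> \<open>A basis that is a set of vectors is a family indexed by itself.\<close>
  have "frame K V B (\<lambda>x. x)"
  proof
    show "bij_betw (\<lambda>u. \<Oplus>\<^bsub>V\<^esub>j\<in>B. u j \<odot>\<^bsub>V\<^esub> j) (B \<rightarrow>\<^sub>E carrier K) (carrier V)"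
      unfolding bij_betw_def
    proof
      have cl: "u \<in> B \<rightarrow>\<^sub>E carrier K \<Longrightarrow> lincomb u B \<in> carrier V" for u
        using sub by (intro lincomb_closed) auto
      show "inj_on (\<lambda>u. \<Oplus>\<^bsub>V\<^esub>j\<in>B. u j \<odot>\<^bsub>V\<^esub> j) (B \<rightarrow>\<^sub>E carrier K)"
        using ex1[OF cl] by (fold lincomb_def) (metis (no_types, lifting) inj_onI)
      show "(\<lambda>u. \<Oplus>\<^bsub>V\<^esub>j\<in>B. u j \<odot>\<^bsub>V\<^esub> j) ` (B \<rightarrow>\<^sub>E carrier K) = carrier V"
        using ex1 cl by (fold lincomb_def) blast
    qed
  qed (use B sub in auto)
  moreover from this have "card B = dim"
    by (rule frame.dim_eq_card[symmetric])
  then obtain e where "bij_betw e {..<dim} B"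
    using ex_bij_betw_nat_finite[OF B(1)] by (auto simp: atLeast0LessThan)
  ultimately show ?thesis
    using frame.reindex that by blast
qed

lemma frame_cong:
  assumes "frame K V J b" "\<And>j. j \<in> J \<Longrightarrow> b j = c j"
  shows "frame K V J c"
proof -
  interpret frame K V J b by fact
  show ?thesis
  proof
    have "(\<Oplus>\<^bsub>V\<^esub>j\<in>J. u j \<odot>\<^bsub>V\<^esub> c j) = comb u" if "u \<in> J \<rightarrow>\<^sub>E carrier K" for u
      using that assms(2) b_closed by (intro finsum_cong') (auto simp: PiE_mem)
    then show "bij_betw (\<lambda>u. \<Oplus>\<^bsub>V\<^esub>j\<in>J. u j \<odot>\<^bsub>V\<^esub> c j) (J \<rightarrow>\<^sub>E carrier K) (carrier V)"
      by (subst bij_betw_cong) (auto intro: comb_bij)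
  qed (use assms(2) finite_J b_closed in auto)
qed

lemma (in abelian_monoid) finsum_Sigma:
  assumes "finite I" "\<And>i. i \<in> I \<Longrightarrow> finite (J i)"
    and "\<And>i j. i \<in> I \<Longrightarrow> j \<in> J i \<Longrightarrow> f i j \<in> carrier G"
  shows "(\<Oplus>p\<in>Sigma I J. f (fst p) (snd p)) = (\<Oplus>i\<in>I. \<Oplus>j\<in>J i. f i j)"
  using assms
proof (induction I)
  case (insert i I)
  have inner: "(\<Oplus>p\<in>Pair i ` J i. f (fst p) (snd p)) = (\<Oplus>j\<in>J i. f i j)"
    using insert.prems by (subst finsum_reindex) (auto simp: inj_on_def)
  have "(\<Oplus>p\<in>Sigma (insert i I) J. f (fst p) (snd p)) =
      (\<Oplus>p\<in>Pair i ` J i \<union> Sigma I J. f (fst p) (snd p))"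
    by (rule arg_cong[where f = "finsum G _"]) auto
  also have "\<dots> = (\<Oplus>p\<in>Pair i ` J i. f (fst p) (snd p)) \<oplus> (\<Oplus>p\<in>Sigma I J. f (fst p) (snd p))"
    using insert by (intro finsum_Un_disjoint) auto
  also have "(\<Oplus>p\<in>Sigma I J. f (fst p) (snd p)) = (\<Oplus>i\<in>I. \<Oplus>j\<in>J i. f i j)"
    using insert by auto
  finally show ?case
    using insert inner by (subst finsum_insert) (auto intro!: finsum_closed)
qed simp

section \<open>Finite-dimensional spaces and their isomorphisms\<close>

lemma fin_vectD:
  assumes "V \<in> fin_vect k"
  shows "vectorspace k V" "vectorspace.fin_dim k V"
  using assms by (auto simp: fin_vect_def)

lemma fin_vect_frame:
  assumes "V \<in> fin_vect k"
  obtains b where "frame k V {..<vectorspace.dim k V} b"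
  using vectorspace.frame_exists[of k V] assms by (auto simp: fin_vect_def)

lemma frame_fin_vect: "frame k V J b \<Longrightarrow> V \<in> fin_vect k"
  using frame.axioms(1) frame.fin_dim by (auto simp: fin_vect_def)

lemma linI: "linear_map k V W f \<Longrightarrow> f \<in> extensional (carrier V) \<Longrightarrow> f \<in> lin k V W"
  by (simp add: lin_def)

lemma frame_extend_lin:
  assumes "frame k V J b" "vectorspace k W" "\<And>j. j \<in> J \<Longrightarrow> c j \<in> carrier W"
  shows "frame.extend k V J b W c \<in> lin k V W"
  using assms by (intro linI frame.extend_linear frame.extend_extensional)

lemma frame_lin_eqI:
  assumes "frame k V J b" "f \<in> lin k V W" "g \<in> lin k V W" "\<And>j. j \<in> J \<Longrightarrow> f (b j) = g (b j)"
  shows "f = g"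
proof (rule extensionalityI[OF linD(2)[OF assms(2)] linD(2)[OF assms(3)]])
  show "f v = g v" if "v \<in> carrier V" for v
    using frame.linear_eqI[OF assms(1) linD(1)[OF assms(2)] linD(1)[OF assms(3)] _ that] assms(4)
    by blast
qed

lemma lin_compose:
  assumes f: "f \<in> lin k U V" and g: "g \<in> lin k V W"
  shows "compose (carrier U) g f \<in> lin k U W"
proof (rule linI)
  show "linear_map k U W (compose (carrier U) g f)"
    using linear_map_comp[OF linD(1)[OF f] linD(1)[OF g]]
    by (rule linear_map_cong) (simp add: compose_eq)
qed (simp add: compose_def)

lemma lin_id:
  assumes "vectorspace k V"
  shows "(\<lambda>v\<in>carrier V. v) \<in> lin k V V"
  using linear_map_cong[OF vectorspace.linear_map_identity[OF assms], of "\<lambda>v\<in>carrier V. v"]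
  by (intro linI) auto

lemma lin_zero:
  assumes "vectorspace k V" "vectorspace k W"
  shows "(\<lambda>v\<in>carrier V. \<zero>\<^bsub>W\<^esub>) \<in> lin k V W"
proof -
  interpret V: vectorspace k V by fact
  interpret W: vectorspace k W by fact
  show ?thesis
    by (intro linI linear_mapI assms) auto
qed

lemma lin_add:
  assumes f: "f \<in> lin k V W" and g: "g \<in> lin k V W"
  shows "(\<lambda>v\<in>carrier V. f v \<oplus>\<^bsub>W\<^esub> g v) \<in> lin k V W"
  using linear_map_cong[OF linear_map_sum[OF linD(1)[OF f] linD(1)[OF g]], of "\<lambda>v\<in>carrier V. f v \<oplus>\<^bsub>W\<^esub> g v"]
  by (intro linI) auto

text \<open>The condition that \<open>iso_obj\<close> places on a pair of morphisms of families,
  taken at a single index.\<close>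

definition inverse_lin where
  "inverse_lin k V W f g \<longleftrightarrow> f \<in> lin k V W \<and> g \<in> lin k W V \<and>
     compose (carrier V) g f = (\<lambda>v\<in>carrier V. v) \<and> compose (carrier W) f g = (\<lambda>w\<in>carrier W. w)"

text \<open>An isomorphism is a bijective linear map and as such preserves dimension; conversely,
  bases over a common index set are exchanged by two mutually inverse linear extensions.\<close>

lemma inverse_lin_iff_dim:
  assumes V: "V \<in> fin_vect k" and W: "W \<in> fin_vect k"
  shows "(\<exists>f g. inverse_lin k V W f g) \<longleftrightarrow> vectorspace.dim k V = vectorspace.dim k W"
proof
  assume "\<exists>f g. inverse_lin k V W f g"
  then obtain f g where fg: "f \<in> lin k V W" "g \<in> lin k W V"
    "compose (carrier V) g f = (\<lambda>v\<in>carrier V. v)" "compose (carrier W) f g = (\<lambda>w\<in>carrier W. w)"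
    by (auto simp: inverse_lin_def)
  have "g (f v) = v" if "v \<in> carrier V" for v
    using fun_cong[OF fg(3), of v] that by (simp add: compose_eq)
  moreover have "f (g w) = w" if "w \<in> carrier W" for w
    using fun_cong[OF fg(4), of w] that by (simp add: compose_eq)
  ultimately have "bij_betw f (carrier V) (carrier W)"
    using linear_map_closed[OF linD(1)[OF fg(1)]] linear_map_closed[OF linD(1)[OF fg(2)]]
    by (intro bij_betw_byWitness[where f' = g]) auto
  then show "vectorspace.dim k V = vectorspace.dim k W"
    using linear_map.dim_eq[OF linD(1)[OF fg(1)] fin_vectD(2)[OF V]] by (simp add: bij_betw_def)
next
  assume eq: "vectorspace.dim k V = vectorspace.dim k W"
  obtain b where b: "frame k V {..<vectorspace.dim k V} b" by (rule fin_vect_frame[OF V])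
  obtain c where c: "frame k W {..<vectorspace.dim k V} c" by (rule fin_vect_frame[OF W, folded eq])
  interpret b: frame k V "{..<vectorspace.dim k V}" b by fact
  interpret c: frame k W "{..<vectorspace.dim k V}" c by fact
  have ext: "b.extend W c (b j) = c j" "c.extend V b (c j) = b j" if "j < vectorspace.dim k V" for j
    using that fin_vectD(1)[OF V] fin_vectD(1)[OF W] b.b_closed c.b_closed
    by (intro b.extend_b c.extend_b; simp)+
  have f: "b.extend W c \<in> lin k V W" and g: "c.extend V b \<in> lin k W V"
    using fin_vectD(1)[OF V] fin_vectD(1)[OF W] b c b.b_closed c.b_closed
    by (auto intro!: frame_extend_lin)
  have "compose (carrier V) (c.extend V b) (b.extend W c) = (\<lambda>v\<in>carrier V. v)"
    using fin_vectD(1)[OF V] fin_vectD(1)[OF W] b.b_closed c.b_closed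
    by (intro frame_lin_eqI[OF b lin_compose[OF f g] lin_id])
      (auto simp: compose_eq ext)
  moreover have "compose (carrier W) (b.extend W c) (c.extend V b) = (\<lambda>v\<in>carrier W. v)"
    using fin_vectD(1)[OF V] fin_vectD(1)[OF W] b.b_closed c.b_closed
    by (intro frame_lin_eqI[OF c lin_compose[OF g f] lin_id])
      (auto simp: compose_eq ext)
  ultimately show "\<exists>f g. inverse_lin k V W f g"
    using f g by (auto simp: inverse_lin_def)
qed

lemma dim_eq_0_iff:
  assumes V: "V \<in> fin_vect k"
  shows "vectorspace.dim k V = 0 \<longleftrightarrow> carrier V = {\<zero>\<^bsub>V\<^esub>}"
proof
  interpret vectorspace k V using fin_vectD(1)[OF V] .
  assume "carrier V = {\<zero>\<^bsub>V\<^esub>}"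
  moreover have "span {\<zero>\<^bsub>V\<^esub>} \<subseteq> carrier V" "\<zero>\<^bsub>V\<^esub> \<in> span {\<zero>\<^bsub>V\<^esub>}"
    using span_closed[of "{\<zero>\<^bsub>V\<^esub>}"] span_zero by auto
  ultimately show "dim = 0"
    by (intro dim0I) auto
next
  assume 0: "vectorspace.dim k V = 0"
  obtain b where "frame k V {..<vectorspace.dim k V} b" by (rule fin_vect_frame[OF V])
  then interpret frame k V "{..<vectorspace.dim k V}" b .
  \<comment> \<open>The index set is empty, so there is exactly one coefficient function, and its
    combination is the empty sum.\<close>
  from comb_bij show "carrier V = {\<zero>\<^bsub>V\<^esub>}"
    by (simp add: 0 bij_betw_def)
qed

text \<open>
  In the coordinates given by the frames of the summands, the map on the left becomes the linear
  combination map of the family on the right.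
\<close>

lemma direct_sum_iff_frame:
  assumes I: "finite I" and b: "\<And>i. i \<in> I \<Longrightarrow> frame k (F i) (J i) (b i)"
    and S: "vectorspace k S" and \<iota>: "\<And>i. i \<in> I \<Longrightarrow> linear_map k (F i) S (\<iota> i)"
  shows "bij_betw (\<lambda>x. \<Oplus>\<^bsub>S\<^esub>i\<in>I. \<iota> i (x i)) (\<Pi>\<^sub>E i\<in>I. carrier (F i)) (carrier S) \<longleftrightarrow>
    frame k S (Sigma I J) (\<lambda>p. \<iota> (fst p) (b (fst p) (snd p)))"
proof -
  interpret S: vectorspace k S by fact
  \<comment> \<open>\<open>A\<close> assembles, in every summand, the vector with the given
    coefficients; \<open>A'\<close> reads the coordinates off again. As \<open>A\<close> is
    bijective, composing with it does not affect whether the map out of the product is a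
    bijection.\<close>
  define A where "A = (\<lambda>u. \<lambda>i\<in>I. \<Oplus>\<^bsub>F i\<^esub>j\<in>J i. u (i, j) \<odot>\<^bsub>F i\<^esub> b i j)"
  define A' where "A' = (\<lambda>x. \<lambda>p\<in>Sigma I J. frame.coord k (F (fst p)) (J (fst p)) (b (fst p)) (x (fst p)) (snd p))"
  define d where "d = (\<lambda>p. \<iota> (fst p) (b (fst p) (snd p)))"
  have fin: "finite (J i)" if "i \<in> I" for i
    using frame.finite_J[OF b[OF that]] .
  have \<iota>b: "\<iota> i (b i j) \<in> carrier S" if "i \<in> I" "j \<in> J i" for i j
    using linear_map_closed[OF \<iota>] frame.b_closed[OF b] that by blast
  have bij: "bij_betw A (Sigma I J \<rightarrow>\<^sub>E carrier k) (\<Pi>\<^sub>E i\<in>I. carrier (F i))"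
  proof (rule bij_betw_byWitness[where f' = A'])
    show "\<forall>u\<in>Sigma I J \<rightarrow>\<^sub>E carrier k. A' (A u) = u"
    proof
      fix u assume u: "u \<in> Sigma I J \<rightarrow>\<^sub>E carrier k"
      show "A' (A u) = u"
      proof (rule PiE_ext[OF _ u])
        have *: "A' (A u) p = u p" if "p \<in> Sigma I J" for p
        proof -
          from that obtain i j where p: "p = (i, j)" "i \<in> I" "j \<in> J i" by auto
          have "u (i, j) \<in> carrier k" if "j \<in> J i" for j using u p that by auto
          then show ?thesis
            using frame.coord_comb[OF b[OF p(2)], of "\<lambda>j. u (i, j)" j] p by (simp add: A_def A'_def)
        qed
        then show "A' (A u) \<in> Sigma I J \<rightarrow>\<^sub>E carrier k"
          using u by (intro PiE_I) (auto simp: A'_def)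
        show "A' (A u) p = u p" if "p \<in> Sigma I J" for p using * that .
      qed
    qed
    show "\<forall>x\<in>\<Pi>\<^sub>E i\<in>I. carrier (F i). A (A' x) = x"
    proof
      fix x assume x: "x \<in> (\<Pi>\<^sub>E i\<in>I. carrier (F i))"
      have *: "A (A' x) i = x i" if i: "i \<in> I" for i
      proof -
        interpret b: frame k "F i" "J i" "b i" by (rule b[OF i])
        have xi: "x i \<in> carrier (F i)" using x i by auto
        have "A (A' x) i = b.comb (\<lambda>j. A' x (i, j))" using i by (simp add: A_def)
        also have "\<dots> = b.comb (b.coord (x i))"
          by (rule b.comb_cong) (use i xi in \<open>auto simp: A'_def\<close>)
        finally show ?thesis using xi by simp
      qed
      then show "A (A' x) = x"
        using x by (intro extensionalityI[where A = I]) (auto simp: A_def PiE_def)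
    qed
    show "A ` (Sigma I J \<rightarrow>\<^sub>E carrier k) \<subseteq> (\<Pi>\<^sub>E i\<in>I. carrier (F i))"
    proof (intro image_subsetI PiE_I)
      fix u i assume u: "u \<in> Sigma I J \<rightarrow>\<^sub>E carrier k" and i: "i \<in> I"
      then have "u (i, j) \<in> carrier k" if "j \<in> J i" for j using that by auto
      then show "A u i \<in> carrier (F i)"
        using frame.comb_closed[OF b[OF i]] i by (simp add: A_def)
    qed (simp add: A_def)
    show "A' ` (\<Pi>\<^sub>E i\<in>I. carrier (F i)) \<subseteq> Sigma I J \<rightarrow>\<^sub>E carrier k"
    proof (intro image_subsetI PiE_I)
      fix x p assume x: "x \<in> (\<Pi>\<^sub>E i\<in>I. carrier (F i))" and p: "p \<in> Sigma I J"
      then have "x (fst p) \<in> carrier (F (fst p))" by auto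
      then show "A' x p \<in> carrier k"
        using frame.coord_closed[OF b, of "fst p" "x (fst p)" "snd p"] p by (auto simp: A'_def)
    qed (simp add: A'_def)
  qed
  have eq: "(\<Oplus>\<^bsub>S\<^esub>i\<in>I. \<iota> i (A u i)) = (\<Oplus>\<^bsub>S\<^esub>p\<in>Sigma I J. u p \<odot>\<^bsub>S\<^esub> d p)"
    if u: "u \<in> Sigma I J \<rightarrow>\<^sub>E carrier k" for u
  proof -
    have cl: "u (i, j) \<in> carrier k" if "i \<in> I" "j \<in> J i" for i j using u that by auto
    have "(\<Oplus>\<^bsub>S\<^esub>p\<in>Sigma I J. u p \<odot>\<^bsub>S\<^esub> d p) = (\<Oplus>\<^bsub>S\<^esub>i\<in>I. \<Oplus>\<^bsub>S\<^esub>j\<in>J i. u (i, j) \<odot>\<^bsub>S\<^esub> \<iota> i (b i j))"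
      using S.finsum_Sigma[OF I fin, where f = "\<lambda>i j. u (i, j) \<odot>\<^bsub>S\<^esub> \<iota> i (b i j)"]
      by (simp add: d_def cl \<iota>b)
    also have "\<dots> = (\<Oplus>\<^bsub>S\<^esub>i\<in>I. \<iota> i (A u i))"
    proof (rule S.finsum_cong')
      fix i assume i: "i \<in> I"
      interpret b: frame k "F i" "J i" "b i" by (rule b[OF i])
      show "(\<Oplus>\<^bsub>S\<^esub>j\<in>J i. u (i, j) \<odot>\<^bsub>S\<^esub> \<iota> i (b i j)) = \<iota> i (A u i)"
        using i cl b.b_closed
        by (simp add: A_def linear_map_finsum[OF \<iota>[OF i] fin[OF i]])
          (intro S.finsum_cong', auto simp: linear_map_smult[OF \<iota>[OF i]] \<iota>b)
    next
      show "(\<lambda>i. \<iota> i (A u i)) \<in> I \<rightarrow> carrier S"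
        using bij_betw_apply[OF bij u] linear_map_closed[OF \<iota>] by (auto simp: PiE_mem)
    qed simp
    finally show ?thesis ..
  qed
  have "bij_betw (\<lambda>x. \<Oplus>\<^bsub>S\<^esub>i\<in>I. \<iota> i (x i)) (\<Pi>\<^sub>E i\<in>I. carrier (F i)) (carrier S) \<longleftrightarrow>
      bij_betw (\<lambda>u. \<Oplus>\<^bsub>S\<^esub>i\<in>I. \<iota> i (A u i)) (Sigma I J \<rightarrow>\<^sub>E carrier k) (carrier S)"
    using bij_betw_comp_iff[OF bij] by (simp add: comp_def)
  also have "\<dots> \<longleftrightarrow> bij_betw (\<lambda>u. \<Oplus>\<^bsub>S\<^esub>p\<in>Sigma I J. u p \<odot>\<^bsub>S\<^esub> d p) (Sigma I J \<rightarrow>\<^sub>E carrier k) (carrier S)"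
    by (rule bij_betw_cong) (rule eq)
  also have "\<dots> \<longleftrightarrow> frame k S (Sigma I J) d"
    using S I fin \<iota>b by (auto simp: frame_def frame_axioms_def d_def)
  finally show ?thesis by (simp add: d_def)
qed

section \<open>Coordinate spaces: a model in every finite dimension\<close>

lemma coord_space_vectorspace:
  assumes "field k"
  shows "vectorspace k (coord_space k n)"
proof -
  interpret field k by fact
  have ag: "abelian_group (coord_space k n)"
  proof (rule abelian_groupI)
    fix x assume x: "x \<in> carrier (coord_space k n)"
    let ?y = "\<lambda>i. if i < n then \<ominus>\<^bsub>k\<^esub> x i else \<zero>\<^bsub>k\<^esub>"
    have "?y \<in> carrier (coord_space k n)" "?y \<oplus>\<^bsub>coord_space k n\<^esub> x = \<zero>\<^bsub>coord_space k n\<^esub>"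
      using x by (auto simp: coord_space_def fun_eq_iff l_neg)
    then show "\<exists>y\<in>carrier (coord_space k n). y \<oplus>\<^bsub>coord_space k n\<^esub> x = \<zero>\<^bsub>coord_space k n\<^esub>" by blast
  next
    fix x y z
    assume "x \<in> carrier (coord_space k n)" "y \<in> carrier (coord_space k n)" "z \<in> carrier (coord_space k n)"
    then have c: "x i \<in> carrier k" "y i \<in> carrier k" "z i \<in> carrier k" for i
      by (cases "i < n"; simp add: coord_space_def)+
    show "x \<oplus>\<^bsub>coord_space k n\<^esub> y \<oplus>\<^bsub>coord_space k n\<^esub> z = x \<oplus>\<^bsub>coord_space k n\<^esub> (y \<oplus>\<^bsub>coord_space k n\<^esub> z)"
      by (simp add: coord_space_def fun_eq_iff c a_assoc)
  next
    fix x y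
    assume "x \<in> carrier (coord_space k n)" "y \<in> carrier (coord_space k n)"
    then have c: "x i \<in> carrier k" "y i \<in> carrier k" for i
      by (cases "i < n"; simp add: coord_space_def)+
    show "x \<oplus>\<^bsub>coord_space k n\<^esub> y = y \<oplus>\<^bsub>coord_space k n\<^esub> x"
      by (simp add: coord_space_def fun_eq_iff c a_comm)
  next
    fix x
    assume "x \<in> carrier (coord_space k n)"
    then have c: "x i \<in> carrier k" for i
      by (cases "i < n"; simp add: coord_space_def)+
    show "\<zero>\<^bsub>coord_space k n\<^esub> \<oplus>\<^bsub>coord_space k n\<^esub> x = x"
      by (simp add: coord_space_def fun_eq_iff c)
  qed (auto simp: coord_space_def)
  have c: "x i \<in> carrier k" if "x \<in> carrier (coord_space k n)" for x i
    using that by (cases "i < n"; simp add: coord_space_def)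
  have "module k (coord_space k n)"
  proof (rule moduleI[OF is_cring ag])
    fix a b x y
    assume ab: "a \<in> carrier k" "b \<in> carrier k"
      and "x \<in> carrier (coord_space k n)" "y \<in> carrier (coord_space k n)"
    then have xy: "x i \<in> carrier k" "y i \<in> carrier k" for i
      using c by auto
    show "(a \<oplus>\<^bsub>k\<^esub> b) \<odot>\<^bsub>coord_space k n\<^esub> x = a \<odot>\<^bsub>coord_space k n\<^esub> x \<oplus>\<^bsub>coord_space k n\<^esub> b \<odot>\<^bsub>coord_space k n\<^esub> x"
      by (simp add: coord_space_def ab xy l_distr)
    show "a \<odot>\<^bsub>coord_space k n\<^esub> (x \<oplus>\<^bsub>coord_space k n\<^esub> y) = a \<odot>\<^bsub>coord_space k n\<^esub> x \<oplus>\<^bsub>coord_space k n\<^esub> a \<odot>\<^bsub>coord_space k n\<^esub> y"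
      by (simp add: coord_space_def ab xy r_distr)
    show "(a \<otimes>\<^bsub>k\<^esub> b) \<odot>\<^bsub>coord_space k n\<^esub> x = a \<odot>\<^bsub>coord_space k n\<^esub> (b \<odot>\<^bsub>coord_space k n\<^esub> x)"
      by (simp add: coord_space_def ab xy m_assoc)
  next
    fix a x assume "a \<in> carrier k" "x \<in> carrier (coord_space k n)"
    then show "a \<odot>\<^bsub>coord_space k n\<^esub> x \<in> carrier (coord_space k n)"
      by (auto simp: coord_space_def)
  next
    fix x assume "x \<in> carrier (coord_space k n)"
    then have "x i \<in> carrier k" for i by (rule c)
    then show "\<one>\<^bsub>k\<^esub> \<odot>\<^bsub>coord_space k n\<^esub> x = x"
      by (simp add: coord_space_def)
  qed
  then show ?thesis
    using \<open>field k\<close> by (simp add: vectorspace_def)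
qed

definition unit_vector :: "('a, 'b) ring_scheme \<Rightarrow> nat \<Rightarrow> nat \<Rightarrow> 'a" where
  "unit_vector k j = (\<lambda>i. if i = j then \<one>\<^bsub>k\<^esub> else \<zero>\<^bsub>k\<^esub>)"

lemma frame_coord_space:
  assumes "field k"
  shows "frame k (coord_space k n) {..<n} (unit_vector k)"
proof -
  interpret vectorspace k "coord_space k n" by (rule coord_space_vectorspace[OF assms])
  show ?thesis
  proof
    have un: "unit_vector k j \<in> carrier (coord_space k n)" if "j < n" for j
      using that by (auto simp: unit_vector_def coord_space_def)
    then show "\<And>j. j \<in> {..<n} \<Longrightarrow> unit_vector k j \<in> carrier (coord_space k n)" by simp
    \<comment> \<open>Stated for all subsets \<open>J\<close> of \<open>{..<n}\<close> so that
      induction over the index set applies.\<close>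
    have comb: "(\<Oplus>\<^bsub>coord_space k n\<^esub>j\<in>J. u j \<odot>\<^bsub>coord_space k n\<^esub> unit_vector k j) =
        (\<lambda>i. if i \<in> J then u i else \<zero>\<^bsub>k\<^esub>)"
      if "finite J" "J \<subseteq> {..<n}" "u \<in> {..<n} \<rightarrow> carrier k" for u J
      using that
    proof (induction J)
      case (insert j J)
      have cl: "u i \<in> carrier k" if "i \<in> insert j J" for i using insert.prems that by auto
      have "(\<Oplus>\<^bsub>coord_space k n\<^esub>j\<in>insert j J. u j \<odot>\<^bsub>coord_space k n\<^esub> unit_vector k j) =
          u j \<odot>\<^bsub>coord_space k n\<^esub> unit_vector k j \<oplus>\<^bsub>coord_space k n\<^esub> (\<lambda>i. if i \<in> J then u i else \<zero>\<^bsub>k\<^esub>)"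
        using insert un cl by (subst finsum_insert) (auto simp: Pi_iff)
      also have "\<dots> = (\<lambda>i. if i \<in> insert j J then u i else \<zero>\<^bsub>k\<^esub>)"
        using insert.hyps cl by (auto simp: coord_space_def unit_vector_def fun_eq_iff)
      finally show ?case .
    next
      case empty
      show ?case by (simp only: finsum_empty) (simp add: coord_space_def)
    qed
    have "bij_betw (\<lambda>u i. if i < n then u i else \<zero>\<^bsub>k\<^esub>) ({..<n} \<rightarrow>\<^sub>E carrier k) (carrier (coord_space k n))"
    proof (rule bij_betw_byWitness[where f' = "\<lambda>v. restrict v {..<n}"])
      show "\<forall>u\<in>{..<n} \<rightarrow>\<^sub>E carrier k. restrict (\<lambda>i. if i < n then u i else \<zero>\<^bsub>k\<^esub>) {..<n} = u"
        by (auto simp: fun_eq_iff PiE_def extensional_def)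
    qed (auto simp: coord_space_def fun_eq_iff PiE_def)
    then show "bij_betw (\<lambda>u. \<Oplus>\<^bsub>coord_space k n\<^esub>j\<in>{..<n}. u j \<odot>\<^bsub>coord_space k n\<^esub> unit_vector k j)
        ({..<n} \<rightarrow>\<^sub>E carrier k) (carrier (coord_space k n))"
      by (rule iffD1[OF bij_betw_cong, rotated]) (simp add: comb PiE_def)
  qed simp
qed

lemma coord_space_fin_vect: "field k \<Longrightarrow> coord_space k n \<in> fin_vect k"
  using frame_fin_vect[OF frame_coord_space] .

lemma dim_coord_space: "field k \<Longrightarrow> vectorspace.dim k (coord_space k n) = n"
  using frame.dim_eq_card[OF frame_coord_space] by simp

section \<open>Direct sums, biproducts and tensor products\<close>

text \<open>Bases of the summands together form a basis of the sum, indexed by pairs of a summand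
  and a basis index; the dimension is the size of that \<open>Sigma\<close> set.\<close>

lemma dim_is_dsum:
  assumes I: "finite I" and F: "\<And>i. i \<in> I \<Longrightarrow> F i \<in> fin_vect k" and S: "is_dsum k I F S \<iota>"
  shows "vectorspace.dim k S = (\<Sum>i\<in>I. vectorspace.dim k (F i))"
proof -
  have "\<forall>i\<in>I. \<exists>b. frame k (F i) {..<vectorspace.dim k (F i)} b"
    using fin_vect_frame[OF F] by blast
  then obtain b where b: "\<And>i. i \<in> I \<Longrightarrow> frame k (F i) {..<vectorspace.dim k (F i)} (b i)"
    by metis
  have "frame k S (Sigma I (\<lambda>i. {..<vectorspace.dim k (F i)})) (\<lambda>p. \<iota> (fst p) (b (fst p) (snd p)))"
    using S direct_sum_iff_frame[OF I b, where S = S and \<iota> = \<iota>] by (auto simp: is_dsum_def fin_vect_def)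
  from frame.dim_eq_card[OF this] show ?thesis
    using I by (simp add: card_SigmaI)
qed

text \<open>The sum is realised in a coordinate space with one coordinate for each pair of a summand
  and a basis index. The numbering \<open>e\<close> of these pairs is an arbitrary
  bijection.\<close>

lemma is_dsum_exists:
  assumes k: "field k" and I: "finite I" and F: "\<And>i. i \<in> I \<Longrightarrow> F i \<in> fin_vect k"
  shows "\<exists>S \<iota>. is_dsum k I F S \<iota>"
proof -
  let ?J = "\<lambda>i. {..<vectorspace.dim k (F i)}"
  have "\<forall>i\<in>I. \<exists>b. frame k (F i) (?J i) b"
    using fin_vect_frame[OF F] by blast
  then obtain b where b: "\<And>i. i \<in> I \<Longrightarrow> frame k (F i) (?J i) (b i)"
    by metis
  let ?n = "card (Sigma I ?J)" and ?S = "coord_space k (card (Sigma I ?J))"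
  have "finite (Sigma I ?J)" using I by auto
  then obtain e where e: "bij_betw e (Sigma I ?J) {..<?n}"
    using ex_bij_betw_finite_nat by (auto simp: atLeast0LessThan)
  have frame: "frame k ?S (Sigma I ?J) (\<lambda>p. unit_vector k (e p))"
    by (rule frame.reindex[OF frame_coord_space[OF k] e])
  have S: "vectorspace k ?S" by (rule coord_space_vectorspace[OF k])
  \<comment> \<open>The \<open>i\<close>-th injection sends the \<open>j\<close>-th basis vector to
    the unit vector numbered \<open>e (i, j)\<close>, so all images together are the standard basis,
    indexed by pairs.\<close>
  define \<iota> where "\<iota> i = frame.extend k (F i) (?J i) (b i) ?S (\<lambda>j. unit_vector k (e (i, j)))" for i
  have cl: "unit_vector k (e (i, j)) \<in> carrier ?S" if "i \<in> I" "j \<in> ?J i" for i j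
    using frame.b_closed[OF frame, of "(i, j)"] that by simp
  have \<iota>: "linear_map k (F i) ?S (\<iota> i)" if "i \<in> I" for i
    unfolding \<iota>_def by (intro frame.extend_linear b that S cl)
  have "frame k ?S (Sigma I ?J) (\<lambda>p. \<iota> (fst p) (b (fst p) (snd p)))"
  proof (rule frame_cong[OF frame])
    fix p assume "p \<in> Sigma I ?J"
    then have p: "fst p \<in> I" "snd p \<in> ?J (fst p)" by auto
    have "\<iota> (fst p) (b (fst p) (snd p)) = unit_vector k (e (fst p, snd p))"
      unfolding \<iota>_def by (rule frame.extend_b[OF b S]) (use cl p in auto)
    then show "unit_vector k (e p) = \<iota> (fst p) (b (fst p) (snd p))" by simp
  qed
  then have "is_dsum k I F ?S \<iota>"
    using direct_sum_iff_frame[OF I b S \<iota>] coord_space_fin_vect[OF k] \<iota> by (simp add: is_dsum_def)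
  then show ?thesis by blast
qed

lemma dsum_is_dsum:
  assumes "field k" "finite I" "\<And>i. i \<in> I \<Longrightarrow> F i \<in> fin_vect k"
  shows "is_dsum k I F (fst (dsum k I F)) (snd (dsum k I F))"
proof -
  have "\<exists>p. is_dsum k I F (fst p) (snd p)"
    using is_dsum_exists[OF assms] by simp
  then show ?thesis
    unfolding dsum_def by (rule someI_ex)
qed

section \<open>Biproducts of vector spaces\<close>

definition biproduct_lin where
  "biproduct_lin k V W Z i j p q \<longleftrightarrow>
     i \<in> lin k V Z \<and> j \<in> lin k W Z \<and> p \<in> lin k Z V \<and> q \<in> lin k Z W \<and>
     compose (carrier V) p i = (\<lambda>v\<in>carrier V. v) \<and> compose (carrier W) q j = (\<lambda>w\<in>carrier W. w) \<and>
     compose (carrier W) p j = (\<lambda>w\<in>carrier W. \<zero>\<^bsub>V\<^esub>) \<and> compose (carrier V) q i = (\<lambda>v\<in>carrier V. \<zero>\<^bsub>W\<^esub>) \<and>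
     (\<lambda>z\<in>carrier Z. compose (carrier Z) i p z \<oplus>\<^bsub>Z\<^esub> compose (carrier Z) j q z) = (\<lambda>z\<in>carrier Z. z)"

text \<open>A biproduct in the categorical sense is a direct sum indexed by the two truth values,
  with \<open>V\<close> at \<open>True\<close> and \<open>W\<close> at \<open>False\<close>; so the
  dimension formula for direct sums applies.\<close>

lemma biproduct_lin_imp_dim:
  assumes V: "V \<in> fin_vect k" and W: "W \<in> fin_vect k" and Z: "Z \<in> fin_vect k"
    and bp: "biproduct_lin k V W Z i j p q"
  shows "vectorspace.dim k Z = vectorspace.dim k V + vectorspace.dim k W"
proof -
  have i: "linear_map k V Z i" and j: "linear_map k W Z j" and p: "linear_map k Z V p" and q: "linear_map k Z W q"
    using bp linD(1) unfolding biproduct_lin_def by blast+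
  interpret V: vectorspace k V using fin_vectD(1)[OF V] .
  interpret W: vectorspace k W using fin_vectD(1)[OF W] .
  interpret Z: vectorspace k Z using fin_vectD(1)[OF Z] .
  \<comment> \<open>Strips the four memberships in \<open>lin\<close> and keeps the five
    equations.\<close>
  note eqs = bp[unfolded biproduct_lin_def, THEN conjunct2, THEN conjunct2, THEN conjunct2, THEN conjunct2]
  have pi: "p (i v) = v" if "v \<in> carrier V" for v
    using fun_cong[OF conjunct1[OF eqs], of v] that by (simp add: compose_eq)
  have qj: "q (j w) = w" if "w \<in> carrier W" for w
    using fun_cong[OF conjunct1[OF conjunct2[OF eqs]], of w] that by (simp add: compose_eq)
  have pj: "p (j w) = \<zero>\<^bsub>V\<^esub>" if "w \<in> carrier W" for w
    using fun_cong[OF conjunct1[OF conjunct2[OF conjunct2[OF eqs]]], of w] that by (simp add: compose_eq)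
  have qi: "q (i v) = \<zero>\<^bsub>W\<^esub>" if "v \<in> carrier V" for v
    using fun_cong[OF conjunct1[OF conjunct2[OF conjunct2[OF conjunct2[OF eqs]]]], of v] that
    by (simp add: compose_eq)
  have ij: "i (p z) \<oplus>\<^bsub>Z\<^esub> j (q z) = z" if "z \<in> carrier Z" for z
    using fun_cong[OF conjunct2[OF conjunct2[OF conjunct2[OF conjunct2[OF eqs]]]], of z] that
    by (simp add: compose_eq)
  let ?F = "\<lambda>c. if c then V else W" and ?\<iota> = "\<lambda>c. if c then i else j"
  have comps: "x True \<in> carrier V \<and> x False \<in> carrier W" if "x \<in> (\<Pi>\<^sub>E c\<in>UNIV. carrier (?F c))" for x
    using PiE_mem[OF that, of True] PiE_mem[OF that, of False] by simp
  \<comment> \<open>The inverse collects the two projections. The four equations between injections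
    and projections give one composite, the splitting of the identity of \<open>Z\<close> the
    other.\<close>
  have "bij_betw (\<lambda>x. i (x True) \<oplus>\<^bsub>Z\<^esub> j (x False)) (\<Pi>\<^sub>E c\<in>UNIV. carrier (?F c)) (carrier Z)"
  proof (rule bij_betw_byWitness[where f' = "\<lambda>z c. if c then p z else q z"])
    show "\<forall>x\<in>\<Pi>\<^sub>E c\<in>UNIV. carrier (?F c).
        (\<lambda>c. if c then p (i (x True) \<oplus>\<^bsub>Z\<^esub> j (x False)) else q (i (x True) \<oplus>\<^bsub>Z\<^esub> j (x False))) = x"
    proof
      fix x assume "x \<in> (\<Pi>\<^sub>E c\<in>UNIV. carrier (?F c))"
      note x = comps[OF this]
      show "(\<lambda>c. if c then p (i (x True) \<oplus>\<^bsub>Z\<^esub> j (x False)) else q (i (x True) \<oplus>\<^bsub>Z\<^esub> j (x False))) = x"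
        using x by (auto simp: fun_eq_iff linear_map_add[OF p] linear_map_add[OF q]
          linear_map_closed[OF i] linear_map_closed[OF j] pi qi pj qj)
    qed
    show "\<forall>z\<in>carrier Z. i (if True then p z else q z) \<oplus>\<^bsub>Z\<^esub> j (if False then p z else q z) = z"
      by (simp add: ij)
    show "(\<lambda>x. i (x True) \<oplus>\<^bsub>Z\<^esub> j (x False)) ` (\<Pi>\<^sub>E c\<in>UNIV. carrier (?F c)) \<subseteq> carrier Z"
      by (intro image_subsetI Z.a_closed linear_map_closed[OF i] linear_map_closed[OF j]; drule comps; simp)
    show "(\<lambda>z c. if c then p z else q z) ` carrier Z \<subseteq> (\<Pi>\<^sub>E c\<in>UNIV. carrier (?F c))"
      by (auto simp: PiE_iff linear_map_closed[OF p] linear_map_closed[OF q])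
  qed
  moreover have "(\<Oplus>\<^bsub>Z\<^esub>c\<in>UNIV. ?\<iota> c (x c)) = i (x True) \<oplus>\<^bsub>Z\<^esub> j (x False)"
    if "x \<in> (\<Pi>\<^sub>E c\<in>UNIV. carrier (?F c))" for x
    using comps[OF that]
    by (simp add: UNIV_bool Z.finsum_insert linear_map_closed[OF i] linear_map_closed[OF j] Z.a_comm)
  ultimately have "bij_betw (\<lambda>x. \<Oplus>\<^bsub>Z\<^esub>c\<in>UNIV. ?\<iota> c (x c)) (\<Pi>\<^sub>E c\<in>UNIV. carrier (?F c)) (carrier Z)"
    by (subst bij_betw_cong)
  then have "is_dsum k UNIV ?F Z ?\<iota>"
    using Z i j by (auto simp: is_dsum_def)
  from dim_is_dsum[OF _ _ this] show ?thesis
    using V W by (simp add: UNIV_bool)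
qed

text \<open>The assumption on dimensions lets a basis of \<open>Z\<close> be cut into a block for
  \<open>V\<close> followed by a block for \<open>W\<close>. The injections include the blocks, each
  projection kills the other block, and all equations are checked on basis vectors.\<close>

lemma dim_imp_biproduct_lin:
  assumes V: "V \<in> fin_vect k" and W: "W \<in> fin_vect k" and Z: "Z \<in> fin_vect k"
    and dim: "vectorspace.dim k Z = vectorspace.dim k V + vectorspace.dim k W"
  shows "\<exists>i j p q. biproduct_lin k V W Z i j p q"
proof -
  interpret V: vectorspace k V using fin_vectD(1)[OF V] .
  interpret W: vectorspace k W using fin_vectD(1)[OF W] .
  interpret Z: vectorspace k Z using fin_vectD(1)[OF Z] .
  note vs = V.vectorspace_axioms W.vectorspace_axioms Z.vectorspace_axioms
  let ?n = "vectorspace.dim k V" and ?m = "vectorspace.dim k W"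
  obtain b where b: "frame k V {..<?n} b" by (rule fin_vect_frame[OF V])
  obtain c where c: "frame k W {..<?m} c" by (rule fin_vect_frame[OF W])
  obtain d where d: "frame k Z {..<?n + ?m} d" by (rule fin_vect_frame[OF Z, unfolded dim])
  interpret b: frame k V "{..<?n}" b by fact
  interpret c: frame k W "{..<?m}" c by fact
  interpret d: frame k Z "{..<?n + ?m}" d by fact
  define i where "i = b.extend Z d"
  \<comment> \<open>The second block starts at position \<open>?n\<close>, hence the shift here and
    its reversal in \<open>q\<close>.\<close>
  define j where "j = c.extend Z (\<lambda>l. d (?n + l))"
  define p where "p = d.extend V (\<lambda>l. if l < ?n then b l else \<zero>\<^bsub>V\<^esub>)"
  define q where "q = d.extend W (\<lambda>l. if l < ?n then \<zero>\<^bsub>W\<^esub> else c (l - ?n))"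
  note closed = b.b_closed c.b_closed d.b_closed
  have ib: "i (b l) = d l" if "l < ?n" for l
    unfolding i_def by (rule b.extend_b) (use that vs closed in auto)
  have jc: "j (c l) = d (?n + l)" if "l < ?m" for l
    unfolding j_def by (rule c.extend_b) (use that vs closed in auto)
  have pd: "p (d l) = (if l < ?n then b l else \<zero>\<^bsub>V\<^esub>)" if "l < ?n + ?m" for l
    unfolding p_def by (rule d.extend_b) (use that vs closed in auto)
  have qd: "q (d l) = (if l < ?n then \<zero>\<^bsub>W\<^esub> else c (l - ?n))" if "l < ?n + ?m" for l
    unfolding q_def by (rule d.extend_b) (use that vs closed in auto)
  have lin: "i \<in> lin k V Z" "j \<in> lin k W Z" "p \<in> lin k Z V" "q \<in> lin k Z W"
    unfolding i_def j_def p_def q_def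
    by (intro frame_extend_lin[OF b] frame_extend_lin[OF c] frame_extend_lin[OF d]; use vs closed in auto)+
  \<comment> \<open>On each basis vector of \<open>Z\<close> one of the two projections vanishes, so
    one summand in the splitting of the identity is the image of zero.\<close>
  have zero: "i \<zero>\<^bsub>V\<^esub> = \<zero>\<^bsub>Z\<^esub>" "j \<zero>\<^bsub>W\<^esub> = \<zero>\<^bsub>Z\<^esub>"
    using lin linear_map_zero linD(1) by blast+
  have "biproduct_lin k V W Z i j p q"
    unfolding biproduct_lin_def
  proof (intro conjI lin)
    show "compose (carrier V) p i = (\<lambda>v\<in>carrier V. v)"
      by (rule frame_lin_eqI[OF b lin_compose lin_id]) (use lin vs closed in \<open>auto simp: compose_eq ib pd\<close>)
    show "compose (carrier W) q j = (\<lambda>v\<in>carrier W. v)"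
      by (rule frame_lin_eqI[OF c lin_compose lin_id]) (use lin vs closed in \<open>auto simp: compose_eq jc qd\<close>)
    show "compose (carrier W) p j = (\<lambda>w\<in>carrier W. \<zero>\<^bsub>V\<^esub>)"
      by (rule frame_lin_eqI[OF c lin_compose lin_zero]) (use lin vs closed in \<open>auto simp: compose_eq jc pd\<close>)
    show "compose (carrier V) q i = (\<lambda>v\<in>carrier V. \<zero>\<^bsub>W\<^esub>)"
      by (rule frame_lin_eqI[OF b lin_compose lin_zero]) (use lin vs closed in \<open>auto simp: compose_eq ib qd\<close>)
    show "(\<lambda>z\<in>carrier Z. compose (carrier Z) i p z \<oplus>\<^bsub>Z\<^esub> compose (carrier Z) j q z) = (\<lambda>z\<in>carrier Z. z)"
    proof (rule frame_lin_eqI[OF d lin_add[OF lin_compose lin_compose] lin_id])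
      fix l assume "l \<in> {..<?n + ?m}"
      then show "(\<lambda>z\<in>carrier Z. compose (carrier Z) i p z \<oplus>\<^bsub>Z\<^esub> compose (carrier Z) j q z) (d l) =
          (\<lambda>z\<in>carrier Z. z) (d l)"
        using closed by (auto simp: compose_eq pd qd zero ib jc)
    qed (use lin vs in auto)
  qed
  then show ?thesis by blast
qed

section \<open>Bilinear maps and tensor products\<close>

lemma bilinearD:
  assumes "bilinear k V W X \<beta>"
  shows "w \<in> carrier W \<Longrightarrow> linear_map k V X (\<lambda>v. \<beta> v w)"
    and "v \<in> carrier V \<Longrightarrow> linear_map k W X (\<beta> v)"
  using assms by (auto simp: bilinear_def)

lemma frame_bilinear_eqI:
  assumes V: "frame k V J b" and W: "frame k W L c"
    and \<beta>: "bilinear k V W X \<beta>" and \<gamma>: "bilinear k V W X \<gamma>"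
    and eq: "\<And>j l. j \<in> J \<Longrightarrow> l \<in> L \<Longrightarrow> \<beta> (b j) (c l) = \<gamma> (b j) (c l)"
    and v: "v \<in> carrier V" and w: "w \<in> carrier W"
  shows "\<beta> v w = \<gamma> v w"
proof (rule frame.linear_eqI[OF V bilinearD(1)[OF \<beta> w] bilinearD(1)[OF \<gamma> w] _ v])
  fix j assume j: "j \<in> J"
  then have bj: "b j \<in> carrier V" by (rule frame.b_closed[OF V])
  show "\<beta> (b j) w = \<gamma> (b j) w"
    by (rule frame.linear_eqI[OF W bilinearD(2)[OF \<beta> bj] bilinearD(2)[OF \<gamma> bj] eq[OF j] w])
qed

lemma bilinear_compose:
  assumes "bilinear k V W X \<beta>" "linear_map k X Y h"
  shows "bilinear k V W Y (\<lambda>v w. h (\<beta> v w))"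
  using assms linear_map_comp unfolding bilinear_def by blast

text \<open>The coordinate of the tensor of \<open>v\<close> and \<open>w\<close> at a pair of basis
  indices is the product of their coordinates; \<open>d\<close> is meant to be a basis of
  \<open>T\<close> indexed by such pairs.\<close>

definition frame_tensor where
  "frame_tensor k V J b W L c T d v w =
     (\<Oplus>\<^bsub>T\<^esub>p\<in>J \<times> L. (frame.coord k V J b v (fst p) \<otimes>\<^bsub>k\<^esub> frame.coord k W L c w (snd p)) \<odot>\<^bsub>T\<^esub> d p)"

text \<open>A bilinear map is determined by its values on pairs of basis vectors, and a linear map
  on \<open>T\<close> may take any prescribed values on \<open>d\<close>. Hence every space with a
  basis indexed by \<open>J \<times> L\<close> serves as a tensor product.\<close>

lemma is_tensor_frame_tensor:
  assumes V: "frame k V J b" and W: "frame k W L c" and T: "frame k T (J \<times> L) d"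
  shows "is_tensor k V W T (frame_tensor k V J b W L c T d)"
proof -
  interpret V: frame k V J b by fact
  interpret W: frame k W L c by fact
  interpret T: frame k T "J \<times> L" d by fact
  note vs = V.vectorspace_axioms W.vectorspace_axioms T.vectorspace_axioms
  let ?t = "frame_tensor k V J b W L c T d"
  have t: "?t v w = T.comb (\<lambda>p. V.coord v (fst p) \<otimes>\<^bsub>k\<^esub> W.coord w (snd p))" for v w
    by (simp add: frame_tensor_def)
  have bil: "bilinear k V W T ?t"
    unfolding bilinear_def
  proof (intro conjI ballI)
    fix w assume w: "w \<in> carrier W"
    show "linear_map k V T (\<lambda>v. ?t v w)"
    proof (rule linear_mapI)
      fix v v' assume v: "v \<in> carrier V" "v' \<in> carrier V"
      have "?t (v \<oplus>\<^bsub>V\<^esub> v') w = T.comb (\<lambda>p. V.coord v (fst p) \<otimes>\<^bsub>k\<^esub> W.coord w (snd p) \<oplus>\<^bsub>k\<^esub>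
          V.coord v' (fst p) \<otimes>\<^bsub>k\<^esub> W.coord w (snd p))"
        unfolding t by (rule T.comb_cong) (use v w in \<open>auto simp: V.coord_add V.R.l_distr\<close>)
      also have "\<dots> = ?t v w \<oplus>\<^bsub>T\<^esub> ?t v' w"
        unfolding t by (rule T.comb_add) (use v w in auto)
      finally show "?t (v \<oplus>\<^bsub>V\<^esub> v') w = ?t v w \<oplus>\<^bsub>T\<^esub> ?t v' w" .
    next
      fix a v assume v: "a \<in> carrier k" "v \<in> carrier V"
      have "?t (a \<odot>\<^bsub>V\<^esub> v) w = T.comb (\<lambda>p. a \<otimes>\<^bsub>k\<^esub> (V.coord v (fst p) \<otimes>\<^bsub>k\<^esub> W.coord w (snd p)))"
        unfolding t by (rule T.comb_cong) (use v w in \<open>auto simp: V.coord_smult V.R.m_assoc\<close>)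
      also have "\<dots> = a \<odot>\<^bsub>T\<^esub> ?t v w"
        unfolding t by (rule T.comb_smult) (use v w in auto)
      finally show "?t (a \<odot>\<^bsub>V\<^esub> v) w = a \<odot>\<^bsub>T\<^esub> ?t v w" .
    qed (use vs w in \<open>auto simp: t intro!: T.comb_closed\<close>)
  next
    fix v assume v: "v \<in> carrier V"
    show "linear_map k W T (?t v)"
    proof (rule linear_mapI)
      fix w w' assume w: "w \<in> carrier W" "w' \<in> carrier W"
      have "?t v (w \<oplus>\<^bsub>W\<^esub> w') = T.comb (\<lambda>p. V.coord v (fst p) \<otimes>\<^bsub>k\<^esub> W.coord w (snd p) \<oplus>\<^bsub>k\<^esub>
          V.coord v (fst p) \<otimes>\<^bsub>k\<^esub> W.coord w' (snd p))"
        unfolding t by (rule T.comb_cong) (use v w in \<open>auto simp: W.coord_add V.R.r_distr\<close>)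
      also have "\<dots> = ?t v w \<oplus>\<^bsub>T\<^esub> ?t v w'"
        unfolding t by (rule T.comb_add) (use v w in auto)
      finally show "?t v (w \<oplus>\<^bsub>W\<^esub> w') = ?t v w \<oplus>\<^bsub>T\<^esub> ?t v w'" .
    next
      fix a w assume w: "a \<in> carrier k" "w \<in> carrier W"
      have "?t v (a \<odot>\<^bsub>W\<^esub> w) = T.comb (\<lambda>p. a \<otimes>\<^bsub>k\<^esub> (V.coord v (fst p) \<otimes>\<^bsub>k\<^esub> W.coord w (snd p)))"
        unfolding t by (rule T.comb_cong) (use v w in \<open>auto simp: W.coord_smult V.R.m_lcomm\<close>)
      also have "\<dots> = a \<odot>\<^bsub>T\<^esub> ?t v w"
        unfolding t by (rule T.comb_smult) (use v w in auto)
      finally show "?t v (a \<odot>\<^bsub>W\<^esub> w) = a \<odot>\<^bsub>T\<^esub> ?t v w" .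
    qed (use vs v in \<open>auto simp: t intro!: T.comb_closed\<close>)
  qed
  \<comment> \<open>The product of coordinates is here a product of two Kronecker deltas.\<close>
  have tb: "?t (b j) (c l) = d (j, l)" if "j \<in> J" "l \<in> L" for j l
  proof -
    have "?t (b j) (c l) = T.comb (\<lambda>p. if p = (j, l) then \<one>\<^bsub>k\<^esub> else \<zero>\<^bsub>k\<^esub>)"
      unfolding t by (rule T.comb_cong) (use that in \<open>auto simp: V.coord_b W.coord_b split: if_splits\<close>)
    then show ?thesis using that T.comb_delta[of "(j, l)"] by simp
  qed
  have "\<exists>!h. h \<in> lin k T X \<and> (\<forall>v\<in>carrier V. \<forall>w\<in>carrier W. h (?t v w) = \<beta> v w)"
    if \<beta>: "bilinear k V W X \<beta>" for X :: "'a vs" and \<beta>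
  proof (rule ex_ex1I)
    \<comment> \<open>\<open>X\<close> is an arbitrary record; that it is a vector space is
      contained in the bilinearity of \<open>\<beta>\<close>, read at the zero vector of
      \<open>W\<close>.\<close>
    have X: "vectorspace k X"
      using linear_map_target[OF bilinearD(1)[OF \<beta> W.zero_closed]] .
    let ?h = "T.extend X (\<lambda>p. \<beta> (b (fst p)) (c (snd p)))"
    have cl: "\<beta> (b (fst p)) (c (snd p)) \<in> carrier X" if "p \<in> J \<times> L" for p
      using that linear_map_closed[OF bilinearD(2)[OF \<beta>]] V.b_closed W.b_closed by auto
    have h: "?h \<in> lin k T X"
      by (rule frame_extend_lin[OF T X cl])
    have "?h (?t v w) = \<beta> v w" if "v \<in> carrier V" "w \<in> carrier W" for v w
    proof (rule frame_bilinear_eqI[OF V W bilinear_compose[OF bil linD(1)[OF h]] \<beta> _ that])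
      fix j l assume jl: "j \<in> J" "l \<in> L"
      then show "?h (?t (b j) (c l)) = \<beta> (b j) (c l)"
        using T.extend_b[OF X cl, where j = "(j, l)"] by (simp add: tb)
    qed
    with h show "\<exists>h. h \<in> lin k T X \<and> (\<forall>v\<in>carrier V. \<forall>w\<in>carrier W. h (?t v w) = \<beta> v w)"
      by blast
  next
    fix h h'
    assume h: "h \<in> lin k T X \<and> (\<forall>v\<in>carrier V. \<forall>w\<in>carrier W. h (?t v w) = \<beta> v w)"
      and h': "h' \<in> lin k T X \<and> (\<forall>v\<in>carrier V. \<forall>w\<in>carrier W. h' (?t v w) = \<beta> v w)"
    show "h = h'"
    proof (rule frame_lin_eqI[OF T])
      fix p assume "p \<in> J \<times> L"
      \<comment> \<open>Each vector of the basis \<open>d\<close> is itself a pure tensor, so the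
        values on pure tensors determine the map.\<close>
      then have "d p = ?t (b (fst p)) (c (snd p))" "b (fst p) \<in> carrier V" "c (snd p) \<in> carrier W"
        using tb V.b_closed W.b_closed by auto
      then show "h (d p) = h' (d p)" using h h' by simp
    qed (use h h' in auto)
  qed
  with bil frame_fin_vect[OF T] show ?thesis
    by (simp add: is_tensor_def)
qed

text \<open>Each universal property yields a map to the other space. The composites agree with the
  identities on pure tensors, and the uniqueness half of the property forces equality.\<close>

lemma is_tensor_unique:
  assumes T: "is_tensor k V W T t" and T': "is_tensor k V W T' t'"
  shows "\<exists>f g. inverse_lin k T T' f g"
proof -
  have univ: "\<exists>!h. h \<in> lin k T X \<and> (\<forall>v\<in>carrier V. \<forall>w\<in>carrier W. h (t v w) = \<beta> v w)"
    if "is_tensor k V W T t" "bilinear k V W X \<beta>" for T X :: "'a vs" and t \<beta>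
    using that by (auto simp: is_tensor_def)
  have bil: "bilinear k V W T t" "bilinear k V W T' t'"
    using T T' by (auto simp: is_tensor_def)
  obtain f where f: "f \<in> lin k T T'" "\<And>v w. v \<in> carrier V \<Longrightarrow> w \<in> carrier W \<Longrightarrow> f (t v w) = t' v w"
    using univ[OF T bil(2)] by blast
  obtain g where g: "g \<in> lin k T' T" "\<And>v w. v \<in> carrier V \<Longrightarrow> w \<in> carrier W \<Longrightarrow> g (t' v w) = t v w"
    using univ[OF T' bil(1)] by blast
  \<comment> \<open>Kept general in \<open>T\<close> and \<open>T'\<close>, so that exchanging their
    roles gives the second composite.\<close>
  have id: "compose (carrier T) g f = (\<lambda>x\<in>carrier T. x)"
    if T: "is_tensor k V W T t" and f: "f \<in> lin k T T'" "\<And>v w. v \<in> carrier V \<Longrightarrow> w \<in> carrier W \<Longrightarrow> f (t v w) = t' v w"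
      and g: "g \<in> lin k T' T" "\<And>v w. v \<in> carrier V \<Longrightarrow> w \<in> carrier W \<Longrightarrow> g (t' v w) = t v w"
    for T T' :: "'a vs" and t t' f g
  proof -
    have bil: "bilinear k V W T t" using T by (simp add: is_tensor_def)
    have cl: "t v w \<in> carrier T" if "v \<in> carrier V" "w \<in> carrier W" for v w
      using linear_map_closed[OF bilinearD(2)[OF bil that(1)] that(2)] .
    have "\<forall>v\<in>carrier V. \<forall>w\<in>carrier W. compose (carrier T) g f (t v w) = t v w"
      "\<forall>v\<in>carrier V. \<forall>w\<in>carrier W. (\<lambda>x\<in>carrier T. x) (t v w) = t v w"
      using f g cl by (auto simp: compose_eq)
    moreover have "(\<lambda>x\<in>carrier T. x) \<in> lin k T T"
      using linear_map_source[OF linD(1)[OF f(1)]] by (rule lin_id)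
    ultimately show ?thesis
      using univ[OF T bil] lin_compose[OF f(1) g(1)] by blast
  qed
  have "inverse_lin k T T' f g"
    using f g id[OF T f g] id[OF T' g f] by (simp add: inverse_lin_def)
  then show ?thesis by blast
qed

text \<open>An explicit tensor product in a coordinate space justifies the choice behind
  \<open>tensor\<close>. The chosen space is isomorphic to the explicit one, whose dimension is
  known.\<close>

lemma
  assumes k: "field k" and V: "V \<in> fin_vect k" and W: "W \<in> fin_vect k"
  shows tensor_is_tensor: "is_tensor k V W (fst (tensor k V W)) (snd (tensor k V W))"
    and dim_tensor: "vectorspace.dim k (fst (tensor k V W)) = vectorspace.dim k V * vectorspace.dim k W"
proof -
  let ?n = "vectorspace.dim k V" and ?m = "vectorspace.dim k W"
  let ?T = "coord_space k (?n * ?m)"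
  obtain b where b: "frame k V {..<?n} b" by (rule fin_vect_frame[OF V])
  obtain c where c: "frame k W {..<?m} c" by (rule fin_vect_frame[OF W])
  have "card ({..<?n} \<times> {..<?m}) = ?n * ?m" by (simp add: card_cartesian_product)
  then obtain e where e: "bij_betw e ({..<?n} \<times> {..<?m}) {..<?n * ?m}"
    using ex_bij_betw_finite_nat[of "{..<?n} \<times> {..<?m}"] by (auto simp: atLeast0LessThan)
  note * = is_tensor_frame_tensor[OF b c frame.reindex[OF frame_coord_space[OF k] e]]
  then have "\<exists>p. is_tensor k V W (fst p) (snd p)" by auto
  then show tens: "is_tensor k V W (fst (tensor k V W)) (snd (tensor k V W))"
    unfolding tensor_def by (rule someI_ex)
  have "fst (tensor k V W) \<in> fin_vect k" using tens by (simp add: is_tensor_def)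
  then show "vectorspace.dim k (fst (tensor k V W)) = ?n * ?m"
    using is_tensor_unique[OF tens *] inverse_lin_iff_dim coord_space_fin_vect[OF k] dim_coord_space[OF k]
    by metis
qed

section \<open>Group completions and gradings\<close>

text \<open>\<open>S\<close> is bare data closed under its operations; every law is inherited from
  the ring \<open>R\<close> through the injective map \<open>\<phi>\<close>. The last assumption,
  that each element of \<open>R\<close> is a difference of values of \<open>\<phi>\<close>, makes
  \<open>R\<close> a model of the group completion.\<close>

locale difference_ring = ring R for S :: "('s, 'e) ring_scheme" and R :: "('r, 'f) ring_scheme" (structure) +
  fixes \<phi> :: "'s \<Rightarrow> 'r"
  assumes S_closed: "\<zero>\<^bsub>S\<^esub> \<in> carrier S" "\<one>\<^bsub>S\<^esub> \<in> carrier S"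
      "a \<in> carrier S \<Longrightarrow> b \<in> carrier S \<Longrightarrow> a \<oplus>\<^bsub>S\<^esub> b \<in> carrier S"
      "a \<in> carrier S \<Longrightarrow> b \<in> carrier S \<Longrightarrow> a \<otimes>\<^bsub>S\<^esub> b \<in> carrier S"
    and \<phi>_closed: "a \<in> carrier S \<Longrightarrow> \<phi> a \<in> carrier R"
    and \<phi>_inj: "inj_on \<phi> (carrier S)"
    and \<phi>_zero: "\<phi> \<zero>\<^bsub>S\<^esub> = \<zero>"
    and \<phi>_one: "\<phi> \<one>\<^bsub>S\<^esub> = \<one>"
    and \<phi>_add: "a \<in> carrier S \<Longrightarrow> b \<in> carrier S \<Longrightarrow> \<phi> (a \<oplus>\<^bsub>S\<^esub> b) = \<phi> a \<oplus> \<phi> b"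
    and \<phi>_mult: "a \<in> carrier S \<Longrightarrow> b \<in> carrier S \<Longrightarrow> \<phi> (a \<otimes>\<^bsub>S\<^esub> b) = \<phi> a \<otimes> \<phi> b"
    and differences: "r \<in> carrier R \<Longrightarrow> \<exists>a \<in> carrier S. \<exists>b \<in> carrier S. r = \<phi> a \<ominus> \<phi> b"
begin

text \<open>All formal differences with value \<open>r\<close>. These sets are exactly the elements
  of the group completion, so \<open>fibre\<close> is itself the isomorphism, with no
  representatives to choose.\<close>

definition fibre :: "'r \<Rightarrow> ('s \<times> 's) set" where
  "fibre r = {(a, b). a \<in> carrier S \<and> b \<in> carrier S \<and> \<phi> a \<ominus> \<phi> b = r}"

lemma diff_eq_iff:
  assumes "x \<in> carrier R" "y \<in> carrier R" "z \<in> carrier R" "w \<in> carrier R"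
  shows "x \<ominus> y = z \<ominus> w \<longleftrightarrow> x \<oplus> w = z \<oplus> y"
proof
  assume "x \<ominus> y = z \<ominus> w"
  then have "(x \<ominus> y) \<oplus> (y \<oplus> w) = (z \<ominus> w) \<oplus> (y \<oplus> w)" by simp
  moreover have "(x \<ominus> y) \<oplus> (y \<oplus> w) = x \<oplus> w"
    using assms by (simp add: minus_eq a_assoc r_neg1)
  moreover have "(z \<ominus> w) \<oplus> (y \<oplus> w) = z \<oplus> y"
    using assms by (simp add: minus_eq a_comm[of y w] a_assoc r_neg1)
  ultimately show "x \<oplus> w = z \<oplus> y" by simp
next
  assume "x \<oplus> w = z \<oplus> y"
  then have "(x \<oplus> w) \<oplus> (\<ominus> y \<oplus> \<ominus> w) = (z \<oplus> y) \<oplus> (\<ominus> y \<oplus> \<ominus> w)" by simp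
  moreover have "(x \<oplus> w) \<oplus> (\<ominus> y \<oplus> \<ominus> w) = x \<ominus> y"
    using assms by (simp add: minus_eq a_comm[of "\<ominus> y" "\<ominus> w"] a_assoc r_neg2)
  moreover have "(z \<oplus> y) \<oplus> (\<ominus> y \<oplus> \<ominus> w) = z \<ominus> w"
    using assms by (simp add: minus_eq a_assoc r_neg2)
  ultimately show "x \<ominus> y = z \<ominus> w" by simp
qed

text \<open>After applying \<open>\<phi>\<close> the summand \<open>e\<close> cancels in the
  additive group of \<open>R\<close>; in the other direction the zero of \<open>S\<close> can serve
  as \<open>e\<close>.\<close>

lemma completion_rel_iff:
  "((a, b), (c, d)) \<in> completion_rel S \<longleftrightarrow>
    a \<in> carrier S \<and> b \<in> carrier S \<and> c \<in> carrier S \<and> d \<in> carrier S \<and> \<phi> a \<ominus> \<phi> b = \<phi> c \<ominus> \<phi> d"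
proof (cases "a \<in> carrier S \<and> b \<in> carrier S \<and> c \<in> carrier S \<and> d \<in> carrier S")
  case True
  then have *: "a \<oplus>\<^bsub>S\<^esub> d \<oplus>\<^bsub>S\<^esub> e = c \<oplus>\<^bsub>S\<^esub> b \<oplus>\<^bsub>S\<^esub> e \<longleftrightarrow> \<phi> a \<oplus> \<phi> d = \<phi> c \<oplus> \<phi> b" if "e \<in> carrier S" for e
    using that inj_on_eq_iff[OF \<phi>_inj, of "a \<oplus>\<^bsub>S\<^esub> d \<oplus>\<^bsub>S\<^esub> e" "c \<oplus>\<^bsub>S\<^esub> b \<oplus>\<^bsub>S\<^esub> e"]
    by (simp add: \<phi>_add S_closed \<phi>_closed)
  then have "((a, b), (c, d)) \<in> completion_rel S \<longleftrightarrow> \<phi> a \<oplus> \<phi> d = \<phi> c \<oplus> \<phi> b"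
    using True S_closed(1) unfolding completion_rel_def by auto
  with True show ?thesis by (simp add: diff_eq_iff \<phi>_closed)
qed (auto simp: completion_rel_def)

lemma diff_class_eq:
  "a \<in> carrier S \<Longrightarrow> b \<in> carrier S \<Longrightarrow> diff_class S a b = fibre (\<phi> a \<ominus> \<phi> b)"
  by (auto simp: diff_class_def fibre_def completion_rel_iff)

lemma fibre_nonempty: "r \<in> carrier R \<Longrightarrow> fibre r \<noteq> {}"
  using differences[of r] by (auto simp: fibre_def)

lemma carrier_group_completion: "carrier (group_completion S) = fibre ` carrier R"
proof -
  have "carrier (group_completion S) = (\<lambda>(a, b). diff_class S a b) ` (carrier S \<times> carrier S)"
    by (auto simp: group_completion_def quotient_def diff_class_def)
  also have "\<dots> = fibre ` carrier R"
  proof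
    show "(\<lambda>(a, b). diff_class S a b) ` (carrier S \<times> carrier S) \<subseteq> fibre ` carrier R"
      by (auto simp: diff_class_eq \<phi>_closed)
    show "fibre ` carrier R \<subseteq> (\<lambda>(a, b). diff_class S a b) ` (carrier S \<times> carrier S)"
    proof
      fix X assume "X \<in> fibre ` carrier R"
      then obtain a b where "a \<in> carrier S" "b \<in> carrier S" "X = diff_class S a b"
        using differences diff_class_eq by blast
      then show "X \<in> (\<lambda>(a, b). diff_class S a b) ` (carrier S \<times> carrier S)"
        by (intro image_eqI[of _ _ "(a, b)"]) auto
    qed
  qed
  finally show ?thesis .
qed

text \<open>The operations of \<open>group_completion\<close> are unions over all representatives.
  Fibres are nonempty, so a union whose terms do not depend on the representatives collapses to the
  common term.\<close>

lemma UN_fibre: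
  assumes "x \<in> carrier R" "y \<in> carrier R"
    and "\<And>a b c d. (a, b) \<in> fibre x \<Longrightarrow> (c, d) \<in> fibre y \<Longrightarrow> F a b c d = C"
  shows "(\<Union>(a, b) \<in> fibre x. \<Union>(c, d) \<in> fibre y. F a b c d) = C"
  using fibre_nonempty[OF assms(1)] fibre_nonempty[OF assms(2)] assms(3) by fastforce

lemma fibre_iso: "fibre \<in> ring_iso R (group_completion S)"
proof (rule ring_iso_memI)
  show "fibre r \<in> carrier (group_completion S)" if "r \<in> carrier R" for r
    using that by (simp add: carrier_group_completion)
  show "fibre \<one> = \<one>\<^bsub>group_completion S\<^esub>"
    by (simp add: group_completion_def diff_class_eq S_closed \<phi>_one \<phi>_zero minus_eq)
  have "inj_on fibre (carrier R)"
  proof (rule inj_onI)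
    fix r s assume "r \<in> carrier R" "s \<in> carrier R" "fibre r = fibre s"
    then show "r = s" using fibre_nonempty[of r] by (auto simp: fibre_def)
  qed
  then show "bij_betw fibre (carrier R) (carrier (group_completion S))"
    by (simp add: bij_betw_def carrier_group_completion)
next
  fix x y assume xy: "x \<in> carrier R" "y \<in> carrier R"
  have "fibre x \<oplus>\<^bsub>group_completion S\<^esub> fibre y =
      (\<Union>(a, b) \<in> fibre x. \<Union>(c, d) \<in> fibre y. diff_class S (a \<oplus>\<^bsub>S\<^esub> c) (b \<oplus>\<^bsub>S\<^esub> d))"
    by (simp add: group_completion_def)
  also have "\<dots> = fibre (x \<oplus> y)"
  proof (rule UN_fibre[OF xy])
    fix a b c d assume "(a, b) \<in> fibre x" "(c, d) \<in> fibre y"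
    then have *: "a \<in> carrier S" "b \<in> carrier S" "c \<in> carrier S" "d \<in> carrier S"
      "x = \<phi> a \<ominus> \<phi> b" "y = \<phi> c \<ominus> \<phi> d" by (auto simp: fibre_def)
    then have "\<phi> (a \<oplus>\<^bsub>S\<^esub> c) \<ominus> \<phi> (b \<oplus>\<^bsub>S\<^esub> d) = x \<oplus> y"
      by (simp add: \<phi>_add \<phi>_closed minus_eq minus_add a_ac)
    then show "diff_class S (a \<oplus>\<^bsub>S\<^esub> c) (b \<oplus>\<^bsub>S\<^esub> d) = fibre (x \<oplus> y)"
      using * by (simp add: diff_class_eq S_closed)
  qed
  finally show "fibre (x \<oplus> y) = fibre x \<oplus>\<^bsub>group_completion S\<^esub> fibre y" ..
  have "fibre x \<otimes>\<^bsub>group_completion S\<^esub> fibre y = (\<Union>(a, b) \<in> fibre x. \<Union>(c, d) \<in> fibre y.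
      diff_class S (a \<otimes>\<^bsub>S\<^esub> c \<oplus>\<^bsub>S\<^esub> b \<otimes>\<^bsub>S\<^esub> d) (a \<otimes>\<^bsub>S\<^esub> d \<oplus>\<^bsub>S\<^esub> b \<otimes>\<^bsub>S\<^esub> c))"
    by (simp add: group_completion_def)
  also have "\<dots> = fibre (x \<otimes> y)"
  proof (rule UN_fibre[OF xy])
    fix a b c d assume "(a, b) \<in> fibre x" "(c, d) \<in> fibre y"
    then have *: "a \<in> carrier S" "b \<in> carrier S" "c \<in> carrier S" "d \<in> carrier S"
      "x = \<phi> a \<ominus> \<phi> b" "y = \<phi> c \<ominus> \<phi> d" by (auto simp: fibre_def)
    then have "\<phi> (a \<otimes>\<^bsub>S\<^esub> c \<oplus>\<^bsub>S\<^esub> b \<otimes>\<^bsub>S\<^esub> d) \<ominus> \<phi> (a \<otimes>\<^bsub>S\<^esub> d \<oplus>\<^bsub>S\<^esub> b \<otimes>\<^bsub>S\<^esub> c) = x \<otimes> y"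
      by (simp add: \<phi>_add \<phi>_mult \<phi>_closed S_closed minus_eq minus_add l_distr r_distr l_minus r_minus a_ac)
    then show "diff_class S (a \<otimes>\<^bsub>S\<^esub> c \<oplus>\<^bsub>S\<^esub> b \<otimes>\<^bsub>S\<^esub> d) (a \<otimes>\<^bsub>S\<^esub> d \<oplus>\<^bsub>S\<^esub> b \<otimes>\<^bsub>S\<^esub> c) = fibre (x \<otimes> y)"
      using * by (simp add: diff_class_eq S_closed)
  qed
  finally show "fibre (x \<otimes> y) = fibre x \<otimes>\<^bsub>group_completion S\<^esub> fibre y" ..
qed

text \<open>The ring structure of \<open>R\<close> is moved along \<open>fibre\<close>. This makes
  the images of zero and one the constants of the new ring; \<open>ring_iso\<close> identifies the
  one, while the zero has to be compared by hand.\<close>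

lemma ring_group_completion: "ring (group_completion S)"
proof -
  have "fibre \<zero> = \<zero>\<^bsub>group_completion S\<^esub>"
    by (simp add: group_completion_def diff_class_eq S_closed \<phi>_zero minus_eq)
  then show ?thesis
    using ring_iso_imp_img_ring[OF fibre_iso] ring_iso_memE(4)[OF fibre_iso] by simp
qed

end

text \<open>Homogeneous decompositions are pushed forward by \<open>h\<close>. For uniqueness, the
  components of a decomposition in \<open>S\<close> are lifted to the grades of \<open>R\<close>;
  injectivity of \<open>h\<close> shows that the lifts decompose one and the same element, so they
  agree.\<close>

lemma graded_ring_iso_image:
  assumes RG: "graded_ring R G" and S: "ring S" and h: "h \<in> ring_iso R S"
  shows "graded_ring S (\<lambda>m. h ` G m)"
proof -
  interpret R: graded_ring R G by fact
  interpret S: ring S by fact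
  have hom: "h \<in> ring_hom R S" and bij: "bij_betw h (carrier R) (carrier S)"
    using h by (auto simp: ring_iso_def)
  interpret h: ring_hom_ring R S h
    by (rule ring_hom_ringI2[OF R.ring_axioms S hom])
  have G: "G m \<subseteq> carrier R" for m
    using additive_subgroup.a_subset[OF R.grade_subgroup] .
  have inj: "inj_on h (carrier R)" using bij by (simp add: bij_betw_def)
  have zero_iff: "h x = \<zero>\<^bsub>S\<^esub> \<longleftrightarrow> x = \<zero>\<^bsub>R\<^esub>" if "x \<in> carrier R" for x
    using inj_on_eq_iff[OF inj that R.zero_closed] by simp
  \<comment> \<open>The sums run over the nonzero components, and an injective \<open>h\<close>
    leaves this index set unchanged.\<close>
  have decomp: "(\<Oplus>\<^bsub>S\<^esub>m\<in>{m. h (f m) \<noteq> \<zero>\<^bsub>S\<^esub>}. h (f m)) = h (\<Oplus>\<^bsub>R\<^esub>m\<in>{m. f m \<noteq> \<zero>\<^bsub>R\<^esub>}. f m)"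
    "{m. h (f m) \<noteq> \<zero>\<^bsub>S\<^esub>} = {m. f m \<noteq> \<zero>\<^bsub>R\<^esub>}"
    if "\<And>m::nat. f m \<in> G m" for f
  proof -
    have f: "f m \<in> carrier R" for m using that G by blast
    then show supp: "{m. h (f m) \<noteq> \<zero>\<^bsub>S\<^esub>} = {m. f m \<noteq> \<zero>\<^bsub>R\<^esub>}" by (simp add: zero_iff)
    show "(\<Oplus>\<^bsub>S\<^esub>m\<in>{m. h (f m) \<noteq> \<zero>\<^bsub>S\<^esub>}. h (f m)) = h (\<Oplus>\<^bsub>R\<^esub>m\<in>{m. f m \<noteq> \<zero>\<^bsub>R\<^esub>}. f m)"
      using f by (simp add: supp h.hom_finsum comp_def)
  qed
  show ?thesis
  proof (intro graded_ring.intro graded_ring_axioms.intro S)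
    show "additive_subgroup (h ` G m) S" for m
    proof -
      have "subgroup (G m) (add_monoid R)" using R.grade_subgroup by (simp add: additive_subgroup_def)
      then have "subgroup (h ` G m) (add_monoid S)"
        by (rule group_hom.subgroup_img_is_subgroup[OF h.a_group_hom])
      then show ?thesis by (simp add: additive_subgroup_def)
    qed
    show "\<one>\<^bsub>S\<^esub> \<in> h ` G 0"
      using R.grade_one h.hom_one by (metis image_eqI)
    show "x \<otimes>\<^bsub>S\<^esub> y \<in> h ` G (m + n)" if "x \<in> h ` G m" "y \<in> h ` G n" for x y m n
    proof -
      from that obtain u v where "u \<in> G m" "x = h u" "v \<in> G n" "y = h v" by auto
      then show ?thesis
        using R.grade_mult[of u m v n] G by (intro image_eqI[of _ _ "u \<otimes>\<^bsub>R\<^esub> v"]) (auto simp: subset_iff)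
    qed
    show "\<exists>!f. (\<forall>m. f m \<in> h ` G m) \<and> finite {m. f m \<noteq> \<zero>\<^bsub>S\<^esub>} \<and> y = (\<Oplus>\<^bsub>S\<^esub>m\<in>{m. f m \<noteq> \<zero>\<^bsub>S\<^esub>}. f m)"
      if "y \<in> carrier S" for y
    proof (rule ex_ex1I)
      from bij \<open>y \<in> carrier S\<close> obtain x where x: "x \<in> carrier R" "y = h x"
        by (auto simp: bij_betw_def)
      note ex1 = R.grade_decomp[OF x(1)]
      show "\<exists>f. (\<forall>m. f m \<in> h ` G m) \<and> finite {m. f m \<noteq> \<zero>\<^bsub>S\<^esub>} \<and> y = (\<Oplus>\<^bsub>S\<^esub>m\<in>{m. f m \<noteq> \<zero>\<^bsub>S\<^esub>}. f m)"
      proof -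
        obtain f where f: "\<And>m. f m \<in> G m" "finite {m. f m \<noteq> \<zero>\<^bsub>R\<^esub>}" "x = (\<Oplus>\<^bsub>R\<^esub>m\<in>{m. f m \<noteq> \<zero>\<^bsub>R\<^esub>}. f m)"
          using ex1 by blast
        show ?thesis
          using f decomp[OF f(1)] x(2) by (intro exI[of _ "\<lambda>m. h (f m)"]) simp
      qed
      have lift: "\<exists>f. (\<forall>m. g m = h (f m)) \<and> (\<forall>m. f m \<in> G m) \<and> finite {m. f m \<noteq> \<zero>\<^bsub>R\<^esub>} \<and>
          x = (\<Oplus>\<^bsub>R\<^esub>m\<in>{m. f m \<noteq> \<zero>\<^bsub>R\<^esub>}. f m)"
        if g: "\<forall>m. g m \<in> h ` G m" "finite {m. g m \<noteq> \<zero>\<^bsub>S\<^esub>}" "y = (\<Oplus>\<^bsub>S\<^esub>m\<in>{m. g m \<noteq> \<zero>\<^bsub>S\<^esub>}. g m)" for g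
      proof -
        have "\<forall>m. \<exists>u. u \<in> G m \<and> g m = h u" using g(1) by auto
        then obtain f where f: "\<And>m. f m \<in> G m" "\<And>m. g m = h (f m)" by metis
        have "h x = h (\<Oplus>\<^bsub>R\<^esub>m\<in>{m. f m \<noteq> \<zero>\<^bsub>R\<^esub>}. f m)"
          using g(3) decomp(1)[OF f(1)] x(2) by (simp add: f(2))
        moreover have "(\<Oplus>\<^bsub>R\<^esub>m\<in>{m. f m \<noteq> \<zero>\<^bsub>R\<^esub>}. f m) \<in> carrier R"
          using f(1) G by (intro R.finsum_closed) auto
        ultimately have "x = (\<Oplus>\<^bsub>R\<^esub>m\<in>{m. f m \<noteq> \<zero>\<^bsub>R\<^esub>}. f m)"
          using inj_on_eq_iff[OF inj x(1)] by blast
        then show ?thesis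
          using f g(2) decomp(2)[OF f(1)] by (intro exI[of _ f]) simp
      qed
      fix g g'
      assume "(\<forall>m. g m \<in> h ` G m) \<and> finite {m. g m \<noteq> \<zero>\<^bsub>S\<^esub>} \<and> y = (\<Oplus>\<^bsub>S\<^esub>m\<in>{m. g m \<noteq> \<zero>\<^bsub>S\<^esub>}. g m)"
        and "(\<forall>m. g' m \<in> h ` G m) \<and> finite {m. g' m \<noteq> \<zero>\<^bsub>S\<^esub>} \<and> y = (\<Oplus>\<^bsub>S\<^esub>m\<in>{m. g' m \<noteq> \<zero>\<^bsub>S\<^esub>}. g' m)"
      then show "g = g'"
        using lift[of g] lift[of g'] ex1 by (metis ext)
    qed
  qed
qed

section \<open>Power series of bounded degree\<close>

text \<open>Allows the totals of several indices to be taken over one common finite set, on which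
  \<open>lookup\<close> is additive.\<close>

lemma total_superset:
  assumes "finite A" "Poly_Mapping.keys a \<subseteq> A"
  shows "total a = (\<Sum>i\<in>A. Poly_Mapping.lookup a i)"
  unfolding total_def using assms by (intro sum.mono_neutral_left) (auto simp: in_keys_iff)

lemma total_add: "total (a + b) = total a + total b"
proof -
  let ?A = "Poly_Mapping.keys a \<union> Poly_Mapping.keys b"
  have "total (a + b) = (\<Sum>i\<in>?A. Poly_Mapping.lookup (a + b) i)"
    by (rule total_superset) (auto simp: in_keys_iff lookup_add)
  also have "\<dots> = total a + total b"
    by (simp add: lookup_add sum.distrib total_superset[of ?A a] total_superset[of ?A b])
  finally show ?thesis .
qed

lemma total_zero [simp]: "total 0 = 0"
  by (simp add: total_def)

text \<open>The first part determines the second by cancellation, vanishes off the finite set of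
  keys of \<open>a\<close>, and has entries bounded by those of \<open>a\<close>. The union
  \<open>?B\<close> is a single finite range for all entries.\<close>

lemma finite_splits: "finite (splits a)"
proof -
  let ?B = "\<Union>i\<in>Poly_Mapping.keys a. {..Poly_Mapping.lookup a i}"
  let ?F = "{f. \<forall>i. (i \<in> Poly_Mapping.keys a \<longrightarrow> f i \<in> ?B) \<and> (i \<notin> Poly_Mapping.keys a \<longrightarrow> f i = 0)}"
  have "finite ?F" by (rule finite_set_of_finite_funs) auto
  moreover have "(\<lambda>p. Poly_Mapping.lookup (fst p)) ` splits a \<subseteq> ?F"
  proof (intro image_subsetI CollectI allI conjI impI)
    fix p i assume p: "p \<in> splits a"
    show "Poly_Mapping.lookup (fst p) i \<in> ?B" if "i \<in> Poly_Mapping.keys a"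
      using p that by (intro UN_I[of i]) (auto simp: splits_def lookup_add)
    show "Poly_Mapping.lookup (fst p) i = 0" if "i \<notin> Poly_Mapping.keys a"
      using p that by (auto simp: splits_def lookup_add in_keys_iff)
  qed
  moreover have "inj_on (\<lambda>p. Poly_Mapping.lookup (fst p)) (splits a)"
    by (auto simp: inj_on_def splits_def lookup_inject)
  ultimately show ?thesis
    using finite_imageD finite_subset by blast
qed

lemma splits_iff: "(b, c) \<in> splits a \<longleftrightarrow> b + c = a"
  by (simp add: splits_def)

section \<open>The Cauchy product\<close>

definition conv :: "(index \<Rightarrow> int) \<Rightarrow> (index \<Rightarrow> int) \<Rightarrow> index \<Rightarrow> int" where
  "conv f g a = (\<Sum>(b, c) \<in> splits a. f b * g c)"

text \<open>Both sides sum over all triples of indices with sum \<open>a\<close>, grouped once by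
  the sum of the first two entries and once by the sum of the last two.\<close>

lemma conv_assoc: "conv (conv f g) h = conv f (conv g h)"
proof
  fix a
  have "conv (conv f g) h a = (\<Sum>p\<in>splits a. \<Sum>q\<in>splits (fst p). f (fst q) * g (snd q) * h (snd p))"
    by (simp add: conv_def sum_distrib_right case_prod_beta)
  also have "\<dots> = (\<Sum>(p, q)\<in>Sigma (splits a) (\<lambda>p. splits (fst p)). f (fst q) * g (snd q) * h (snd p))"
    by (rule sum.Sigma) (auto simp: finite_splits)
  \<comment> \<open>The pair \<open>((b + c, d), (b, c))\<close> corresponds to
    \<open>((b, c + d), (c, d))\<close>.\<close>
  also have "\<dots> = (\<Sum>(p, q)\<in>Sigma (splits a) (\<lambda>p. splits (snd p)). f (fst p) * (g (fst q) * h (snd q)))"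
    by (rule sum.reindex_bij_witness[
          where i = "\<lambda>(p, q). ((fst p + fst q, snd q), (fst p, fst q))"
            and j = "\<lambda>(p, q). ((fst q, snd q + snd p), (snd q, snd p))"])
      (auto simp: splits_def add.assoc mult.assoc)
  also have "\<dots> = (\<Sum>p\<in>splits a. \<Sum>q\<in>splits (snd p). f (fst p) * (g (fst q) * h (snd q)))"
    by (rule sum.Sigma[symmetric]) (auto simp: finite_splits)
  also have "\<dots> = conv f (conv g h) a"
    by (simp add: conv_def sum_distrib_left case_prod_beta)
  finally show "conv (conv f g) h a = conv f (conv g h) a" .
qed

lemma conv_one_left: "conv (\<lambda>a. if a = 0 then 1 else 0) f = f"
proof
  fix a
  have "conv (\<lambda>a. if a = 0 then 1 else 0) f a = (\<Sum>p\<in>splits a. if p = (0, a) then f a else 0)"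
    unfolding conv_def by (rule sum.cong) (auto simp: splits_def split: if_splits)
  also have "\<dots> = f a" by (simp add: finite_splits splits_iff)
  finally show "conv (\<lambda>a. if a = 0 then 1 else 0) f a = f a" .
qed

lemma conv_one_right: "conv f (\<lambda>a. if a = 0 then 1 else 0) = f"
proof
  fix a
  have "conv f (\<lambda>a. if a = 0 then 1 else 0) a = (\<Sum>p\<in>splits a. if p = (a, 0) then f a else 0)"
    unfolding conv_def by (rule sum.cong) (auto simp: splits_def split: if_splits)
  also have "\<dots> = f a" by (simp add: finite_splits splits_iff)
  finally show "conv f (\<lambda>a. if a = 0 then 1 else 0) a = f a" .
qed

lemma conv_add_left: "conv (\<lambda>a. f a + g a) h = (\<lambda>a. conv f h a + conv g h a)"
  by (simp add: conv_def fun_eq_iff case_prod_beta distrib_right sum.distrib)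

lemma conv_add_right: "conv h (\<lambda>a. f a + g a) = (\<lambda>a. conv h f a + conv h g a)"
  by (simp add: conv_def fun_eq_iff case_prod_beta distrib_left sum.distrib)

text \<open>A nonzero coefficient stems from a nonzero term. As \<open>total\<close> is additive,
  this controls degrees: it gives the bound for products of bounded series and the degree of
  products of homogeneous ones.\<close>

lemma conv_nonzeroE:
  assumes "conv f g a \<noteq> 0"
  obtains b c where "b + c = a" "f b \<noteq> 0" "g c \<noteq> 0"
proof -
  have "(\<Sum>p\<in>splits a. f (fst p) * g (snd p)) \<noteq> 0"
    using assms by (simp add: conv_def case_prod_beta)
  then obtain p where "p \<in> splits a" "f (fst p) * g (snd p) \<noteq> 0"
    by (rule sum.not_neutral_contains_not_neutral)
  then show ?thesis
    by (intro that[of "fst p" "snd p"]) (auto simp: splits_def)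
qed

lemma bounded_series_ring_simps:
  "carrier bounded_series_ring = {f. \<exists>d. \<forall>a. f a \<noteq> 0 \<longrightarrow> total a \<le> d}"
  "f \<otimes>\<^bsub>bounded_series_ring\<^esub> g = conv f g"
  "\<one>\<^bsub>bounded_series_ring\<^esub> = (\<lambda>a. if a = 0 then 1 else 0)"
  "\<zero>\<^bsub>bounded_series_ring\<^esub> = (\<lambda>a. 0)"
  "f \<oplus>\<^bsub>bounded_series_ring\<^esub> g = (\<lambda>a. f a + g a)"
  by (simp_all add: bounded_series_ring_def conv_def fun_eq_iff)

lemma bounded_series_iff:
  "f \<in> carrier bounded_series_ring \<longleftrightarrow> (\<exists>d. \<forall>a. f a \<noteq> 0 \<longrightarrow> total a \<le> d)"
  by (simp add: bounded_series_ring_simps)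

lemma bounded_series_add:
  assumes "f \<in> carrier bounded_series_ring" "g \<in> carrier bounded_series_ring"
  shows "(\<lambda>a. f a + g a) \<in> carrier bounded_series_ring"
proof -
  obtain d e where "\<And>a. f a \<noteq> 0 \<Longrightarrow> total a \<le> d" "\<And>a. g a \<noteq> 0 \<Longrightarrow> total a \<le> e"
    using assms by (auto simp: bounded_series_iff)
  then have "f a + g a \<noteq> 0 \<Longrightarrow> total a \<le> max d e" for a
    by (metis add.right_neutral le_max_iff_disj)
  then show ?thesis by (auto simp: bounded_series_iff)
qed

lemma bounded_series_conv:
  assumes "f \<in> carrier bounded_series_ring" "g \<in> carrier bounded_series_ring"
  shows "conv f g \<in> carrier bounded_series_ring"
proof -
  obtain d e where "\<And>a. f a \<noteq> 0 \<Longrightarrow> total a \<le> d" "\<And>a. g a \<noteq> 0 \<Longrightarrow> total a \<le> e"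
    using assms by (auto simp: bounded_series_iff)
  then have "conv f g a \<noteq> 0 \<Longrightarrow> total a \<le> d + e" for a
    by (metis conv_nonzeroE total_add add_mono)
  then show ?thesis by (auto simp: bounded_series_iff)
qed

lemma ring_bounded_series: "ring bounded_series_ring"
proof (rule ringI)
  show "abelian_group bounded_series_ring"
  proof (rule abelian_groupI)
    fix f assume "f \<in> carrier bounded_series_ring"
    then show "\<exists>g\<in>carrier bounded_series_ring. g \<oplus>\<^bsub>bounded_series_ring\<^esub> f = \<zero>\<^bsub>bounded_series_ring\<^esub>"
      by (intro bexI[of _ "\<lambda>a. - f a"]) (auto simp: bounded_series_ring_simps)
  next
    fix f g assume "f \<in> carrier bounded_series_ring" "g \<in> carrier bounded_series_ring"
    then show "f \<oplus>\<^bsub>bounded_series_ring\<^esub> g \<in> carrier bounded_series_ring"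
      unfolding bounded_series_ring_simps(5) by (rule bounded_series_add)
  qed (auto simp: bounded_series_ring_simps)
  show "monoid bounded_series_ring"
  proof (rule monoidI)
    fix f g assume "f \<in> carrier bounded_series_ring" "g \<in> carrier bounded_series_ring"
    then show "f \<otimes>\<^bsub>bounded_series_ring\<^esub> g \<in> carrier bounded_series_ring"
      unfolding bounded_series_ring_simps(2) by (rule bounded_series_conv)
  next
    show "\<one>\<^bsub>bounded_series_ring\<^esub> \<in> carrier bounded_series_ring"
      by (auto simp: bounded_series_ring_simps)
  qed (simp_all only: bounded_series_ring_simps(2,3) conv_assoc conv_one_left conv_one_right)
qed (simp_all only: bounded_series_ring_simps(2,5) conv_add_left conv_add_right)

lemma homogeneous_subset: "homogeneous_series m \<subseteq> carrier bounded_series_ring"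
  by (auto simp: homogeneous_series_def bounded_series_iff)

lemma finsum_bounded_series:
  assumes "finite M" "\<And>m. m \<in> M \<Longrightarrow> f m \<in> carrier bounded_series_ring"
  shows "(\<Oplus>\<^bsub>bounded_series_ring\<^esub>m\<in>M. f m) = (\<lambda>a. \<Sum>m\<in>M. f m a)"
proof -
  interpret ring bounded_series_ring by (rule ring_bounded_series)
  show ?thesis
    using assms
  proof (induction M)
    case (insert m M)
    then show ?case
      by (subst finsum_insert) (auto simp: bounded_series_ring_simps(5))
  qed (simp add: bounded_series_ring_simps(4))
qed

lemma graded_ring_bounded_series: "graded_ring bounded_series_ring homogeneous_series"
proof (intro graded_ring.intro graded_ring_axioms.intro ring_bounded_series)
  interpret ring bounded_series_ring by (rule ring_bounded_series)
  show "additive_subgroup (homogeneous_series m) bounded_series_ring" for m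
    unfolding additive_subgroup_def
  proof (rule add.subgroupI)
    show "homogeneous_series m \<subseteq> carrier bounded_series_ring" by (rule homogeneous_subset)
    show "homogeneous_series m \<noteq> {}" by (auto simp: homogeneous_series_def)
    show "f \<oplus>\<^bsub>bounded_series_ring\<^esub> g \<in> homogeneous_series m"
      if "f \<in> homogeneous_series m" "g \<in> homogeneous_series m" for f g
      using that unfolding homogeneous_series_def bounded_series_ring_simps(5)
      by (auto, metis add.right_neutral)
    show "\<ominus>\<^bsub>bounded_series_ring\<^esub> f \<in> homogeneous_series m" if "f \<in> homogeneous_series m" for f
    proof -
      have neg: "(\<lambda>a. - f a) \<in> homogeneous_series m"
        using that by (auto simp: homogeneous_series_def)
      have "\<ominus>\<^bsub>bounded_series_ring\<^esub> f = (\<lambda>a. - f a)"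
        using that neg homogeneous_subset
        by (intro minus_equality) (auto simp: bounded_series_ring_simps(4,5))
      with neg show ?thesis by simp
    qed
  qed
  show "\<one>\<^bsub>bounded_series_ring\<^esub> \<in> homogeneous_series 0"
    by (auto simp: homogeneous_series_def bounded_series_ring_simps)
  show "f \<otimes>\<^bsub>bounded_series_ring\<^esub> g \<in> homogeneous_series (m + n)"
    if "f \<in> homogeneous_series m" "g \<in> homogeneous_series n" for f g m n
    using that unfolding homogeneous_series_def bounded_series_ring_simps(2)
    by (auto elim!: conv_nonzeroE simp: total_add)
  fix x assume x: "x \<in> carrier bounded_series_ring"
  define part where "part = (\<lambda>m a. if total a = m then x a else 0)"
  have part: "part m \<in> homogeneous_series m" for m
    by (auto simp: part_def homogeneous_series_def)
  obtain d where d: "\<And>a. x a \<noteq> 0 \<Longrightarrow> total a \<le> d"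
    using x by (auto simp: bounded_series_iff)
  \<comment> \<open>The bound \<open>d\<close> on the degree kills all later components; this is
    what makes the grades add up to a direct sum and not a product.\<close>
  have "{m. part m \<noteq> \<zero>\<^bsub>bounded_series_ring\<^esub>} \<subseteq> {..d}"
    using d by (auto simp: part_def bounded_series_ring_simps fun_eq_iff split: if_splits)
  then have fin: "finite {m. part m \<noteq> \<zero>\<^bsub>bounded_series_ring\<^esub>}"
    by (rule finite_subset) simp
  \<comment> \<open>At an index \<open>a\<close> only the component of degree \<open>total a\<close>
    contributes. The sum therefore determines every component, which serves both existence and
    uniqueness. If \<open>total a\<close> is outside the support, both sides are 0.\<close>
  have sum: "(\<Oplus>\<^bsub>bounded_series_ring\<^esub>m\<in>{m. f m \<noteq> \<zero>\<^bsub>bounded_series_ring\<^esub>}. f m) = (\<lambda>a. f (total a) a)"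
    if f: "\<And>m. f m \<in> homogeneous_series m" "finite {m. f m \<noteq> \<zero>\<^bsub>bounded_series_ring\<^esub>}" for f
  proof
    fix a
    let ?M = "{m. f m \<noteq> \<zero>\<^bsub>bounded_series_ring\<^esub>}"
    have "(\<Oplus>\<^bsub>bounded_series_ring\<^esub>m\<in>?M. f m) a = (\<Sum>m\<in>?M. f m a)"
      using f homogeneous_subset by (subst finsum_bounded_series) auto
    also have "\<dots> = (\<Sum>m\<in>?M. if m = total a then f (total a) a else 0)"
      using f(1) by (intro sum.cong) (auto simp: homogeneous_series_def)
    also have "\<dots> = f (total a) a"
      using f(2) by (auto simp: bounded_series_ring_simps(4))
    finally show "(\<Oplus>\<^bsub>bounded_series_ring\<^esub>m\<in>?M. f m) a = f (total a) a" .
  qed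
  show "\<exists>!f. (\<forall>m. f m \<in> homogeneous_series m) \<and> finite {m. f m \<noteq> \<zero>\<^bsub>bounded_series_ring\<^esub>} \<and>
      x = (\<Oplus>\<^bsub>bounded_series_ring\<^esub>m\<in>{m. f m \<noteq> \<zero>\<^bsub>bounded_series_ring\<^esub>}. f m)"
  proof (intro ex1I[of _ part] conjI allI part fin)
    show "x = (\<Oplus>\<^bsub>bounded_series_ring\<^esub>m\<in>{m. part m \<noteq> \<zero>\<^bsub>bounded_series_ring\<^esub>}. part m)"
      by (simp add: sum[OF part fin]) (simp add: part_def)
    fix f
    assume f: "(\<forall>m. f m \<in> homogeneous_series m) \<and> finite {m. f m \<noteq> \<zero>\<^bsub>bounded_series_ring\<^esub>} \<and>
      x = (\<Oplus>\<^bsub>bounded_series_ring\<^esub>m\<in>{m. f m \<noteq> \<zero>\<^bsub>bounded_series_ring\<^esub>}. f m)"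
    then have "x = (\<lambda>a. f (total a) a)" using sum[of f] by simp
    then show "f = part"
      using f by (auto simp: part_def fun_eq_iff homogeneous_series_def)
  qed
qed

section \<open>Dimension series of families of vector spaces\<close>

text \<open>Integer values place the series in \<open>bounded_series_ring\<close>, where differences
  can be formed.\<close>

definition dims :: "('a, 'b) ring_scheme \<Rightarrow> 'a fam \<Rightarrow> index \<Rightarrow> int" where
  "dims k x a = int (vectorspace.dim k (x a))"

lemma A_inf_simps:
  "Obj (A_inf k) = fam_obj k" "Hom (A_inf k) = fam_hom k" "Idn (A_inf k) = fam_id"
  "Cmp (A_inf k) x y z = fam_comp x" "Tens (A_inf k) = fam_tens k" "UnitO (A_inf k) = fam_unit k"
  "Grade (A_inf k) = fam_grade k"
  by (simp_all add: A_inf_def)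

lemma fam_obj_fin_vect: "x \<in> fam_obj k \<Longrightarrow> x a \<in> fin_vect k"
  by (simp add: fam_obj_def)

lemma dims_eq_0_iff: "x a \<in> fin_vect k \<Longrightarrow> dims k x a = 0 \<longleftrightarrow> carrier (x a) = {\<zero>\<^bsub>x a\<^esub>}"
  by (simp add: dims_def dim_eq_0_iff)

text \<open>A space is zero exactly when its dimension is, so vanishing in high degrees is a
  condition on the dimension series alone.\<close>

lemma fam_obj_iff:
  "x \<in> fam_obj k \<longleftrightarrow> (\<forall>a. x a \<in> fin_vect k) \<and> dims k x \<in> carrier bounded_series_ring"
proof (cases "\<forall>a. x a \<in> fin_vect k")
  case True
  then have "x \<in> fam_obj k \<longleftrightarrow> (\<exists>d. \<forall>a. total a > d \<longrightarrow> dims k x a = 0)"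
    by (simp add: fam_obj_def dims_eq_0_iff)
  also have "\<dots> \<longleftrightarrow> dims k x \<in> carrier bounded_series_ring"
    by (auto simp: bounded_series_iff) (metis not_le)+
  finally show ?thesis using True by simp
qed (auto simp: fam_obj_def)

lemma fam_grade_iff:
  "x \<in> fam_grade k m \<longleftrightarrow> x \<in> fam_obj k \<and> dims k x \<in> homogeneous_series m"
proof (cases "x \<in> fam_obj k")
  case True
  then have "carrier (x a) = {\<zero>\<^bsub>x a\<^esub>} \<longleftrightarrow> dims k x a = 0" for a
    by (simp add: dims_eq_0_iff fam_obj_fin_vect)
  with True show ?thesis
    unfolding fam_grade_def homogeneous_series_def by blast
qed (simp add: fam_grade_def)

lemma dims_bounded: "x \<in> fam_obj k \<Longrightarrow> dims k x \<in> carrier bounded_series_ring"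
  by (simp add: fam_obj_iff)

text \<open>A morphism of families is an unrestricted family of linear maps. By choice, inverse
  morphisms exist as soon as they exist at every index, where the dimension decides.\<close>

lemma iso_obj_iff_dims:
  assumes x: "x \<in> fam_obj k" and y: "y \<in> fam_obj k"
  shows "iso_obj (A_inf k) x y \<longleftrightarrow> dims k x = dims k y"
proof -
  have "iso_obj (A_inf k) x y \<longleftrightarrow> (\<exists>f g. \<forall>a. inverse_lin k (x a) (y a) (f a) (g a))"
    by (simp add: iso_obj_def A_inf_simps fam_hom_def fam_id_def fam_comp_def inverse_lin_def
        fun_eq_iff[where 'a = index] all_conj_distrib)
  also have "\<dots> \<longleftrightarrow> (\<forall>a. \<exists>f g. inverse_lin k (x a) (y a) f g)"
    by metis
  finally show ?thesis
    by (simp add: inverse_lin_iff_dim fam_obj_fin_vect[OF x] fam_obj_fin_vect[OF y] dims_def fun_eq_iff)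
qed

lemma is_zero_obj_iff_dims:
  assumes x: "x \<in> fam_obj k"
  shows "is_zero_obj (A_inf k) x \<longleftrightarrow> dims k x = (\<lambda>a. 0)"
proof -
  have "(\<lambda>v\<in>carrier (x a). v) = (\<lambda>v\<in>carrier (x a). \<zero>\<^bsub>x a\<^esub>) \<longleftrightarrow> carrier (x a) = {\<zero>\<^bsub>x a\<^esub>}" for a
  proof -
    interpret vectorspace k "x a" by (rule fin_vectD(1)[OF fam_obj_fin_vect[OF x]])
    have "(\<lambda>v\<in>carrier (x a). v) = (\<lambda>v\<in>carrier (x a). \<zero>\<^bsub>x a\<^esub>) \<longleftrightarrow> (\<forall>v\<in>carrier (x a). v = \<zero>\<^bsub>x a\<^esub>)"
    proof
      assume eq: "(\<lambda>v\<in>carrier (x a). v) = (\<lambda>v\<in>carrier (x a). \<zero>\<^bsub>x a\<^esub>)"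
      show "\<forall>v\<in>carrier (x a). v = \<zero>\<^bsub>x a\<^esub>"
      proof
        fix v assume "v \<in> carrier (x a)"
        then show "v = \<zero>\<^bsub>x a\<^esub>" using fun_cong[OF eq, of v] by simp
      qed
    qed (auto intro: restrict_ext)
    then show ?thesis using zero_closed by auto
  qed
  then show ?thesis
    by (simp add: is_zero_obj_def A_inf_simps fam_hom_def fam_id_def fun_eq_iff[where f = "\<lambda>a. (\<lambda>v\<in>carrier (x a). v)"]
        fun_eq_iff[where f = "dims k x"] dims_eq_0_iff fam_obj_fin_vect[OF x])
qed

text \<open>The four structure maps can likewise be chosen index by index, and at each index they
  exist exactly when the dimensions add up.\<close>

lemma is_biproduct_iff_dims:
  assumes x: "x \<in> fam_obj k" and y: "y \<in> fam_obj k" and z: "z \<in> fam_obj k"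
  shows "is_biproduct (A_inf k) x y z \<longleftrightarrow> dims k z = (\<lambda>a. dims k x a + dims k y a)"
proof -
  have "is_biproduct (A_inf k) x y z \<longleftrightarrow>
      (\<exists>i j p q. \<forall>a. biproduct_lin k (x a) (y a) (z a) (i a) (j a) (p a) (q a))"
    unfolding is_biproduct_def A_inf_simps fam_hom_def fam_id_def fam_comp_def biproduct_lin_def
    by (simp add: fun_eq_iff[where 'a = index] all_conj_distrib) blast
  also have "\<dots> \<longleftrightarrow> (\<forall>a. \<exists>i j p q. biproduct_lin k (x a) (y a) (z a) i j p q)"
    by metis
  also have "\<dots> \<longleftrightarrow> (\<forall>a. vectorspace.dim k (z a) = vectorspace.dim k (x a) + vectorspace.dim k (y a))"
    using biproduct_lin_imp_dim dim_imp_biproduct_lin fam_obj_fin_vect[OF x] fam_obj_fin_vect[OF y]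
      fam_obj_fin_vect[OF z] by metis
  also have "\<dots> \<longleftrightarrow> dims k z = (\<lambda>a. dims k x a + dims k y a)"
    by (simp add: dims_def fun_eq_iff flip: of_nat_add)
  finally show ?thesis .
qed

text \<open>The space at \<open>a\<close> is a direct sum over the finitely many splittings of
  \<open>a\<close>, so its dimension is the Cauchy product term by term. The degree bound for
  products of series then gives membership in \<open>fam_obj\<close>.\<close>

lemma
  assumes k: "field k" and x: "x \<in> fam_obj k" and y: "y \<in> fam_obj k"
  shows dims_fam_tens: "dims k (fam_tens k x y) = conv (dims k x) (dims k y)"
    and fam_tens_obj: "fam_tens k x y \<in> fam_obj k"
proof -
  let ?T = "\<lambda>(b, c). fst (tensor k (x b) (y c))"
  have T: "?T p \<in> fin_vect k" for p
    using tensor_is_tensor[OF k fam_obj_fin_vect[OF x] fam_obj_fin_vect[OF y]]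
    by (cases p) (simp add: is_tensor_def)
  have ds: "is_dsum k (splits a) ?T (fam_tens k x y a) (snd (tens_dsum k x y a))" for a
    unfolding fam_tens_def tens_dsum_def by (rule dsum_is_dsum[OF k finite_splits T])
  have "dims k (fam_tens k x y) a = conv (dims k x) (dims k y) a" for a
    using dim_is_dsum[OF finite_splits T ds]
    by (simp add: dims_def conv_def case_prod_beta
        dim_tensor[OF k fam_obj_fin_vect[OF x] fam_obj_fin_vect[OF y]])
  then show dims: "dims k (fam_tens k x y) = conv (dims k x) (dims k y)" ..
  have "fam_tens k x y a \<in> fin_vect k" for a
    using ds by (simp add: is_dsum_def)
  then show "fam_tens k x y \<in> fam_obj k"
    using bounded_series_conv[OF dims_bounded[OF x] dims_bounded[OF y]] by (simp add: fam_obj_iff dims)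
qed

text \<open>Coordinate spaces have every dimension, and \<open>nat\<close> loses nothing on
  nonnegative coefficients.\<close>

lemma fam_obj_exists:
  assumes k: "field k" and f: "f \<in> carrier bounded_series_ring" "\<And>a. f a \<ge> 0"
  obtains x where "x \<in> fam_obj k" "dims k x = f"
proof
  let ?x = "\<lambda>a. coord_space k (nat (f a))"
  show dims: "dims k ?x = f"
    by (simp add: dims_def fun_eq_iff dim_coord_space[OF k] f)
  show "?x \<in> fam_obj k"
    by (simp add: fam_obj_iff dims f(1) coord_space_fin_vect[OF k])
qed

lemma
  assumes k: "field k"
  shows fam_unit_obj: "fam_unit k \<in> fam_obj k"
    and dims_fam_unit: "dims k (fam_unit k) = (\<lambda>a. if a = 0 then 1 else 0)"
proof -
  show dims: "dims k (fam_unit k) = (\<lambda>a. if a = 0 then 1 else 0)"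
    by (simp add: dims_def fam_unit_def fun_eq_iff dim_coord_space[OF k])
  show "fam_unit k \<in> fam_obj k"
    unfolding fam_obj_iff dims
    by (auto simp: fam_unit_def coord_space_fin_vect[OF k] bounded_series_iff)
qed

section \<open>Isomorphism classes as nonnegative series\<close>

lemma iso_class_eq:
  "x \<in> fam_obj k \<Longrightarrow> iso_class (A_inf k) x = {y \<in> fam_obj k. dims k y = dims k x}"
  by (auto simp: iso_class_def A_inf_simps iso_obj_iff_dims)

text \<open>On an isomorphism class all representatives have the same dimension series, so the
  choice does not matter. This is the embedding of the semiring into the series ring.\<close>

definition class_dims :: "('a, 'b) ring_scheme \<Rightarrow> 'a fam set \<Rightarrow> index \<Rightarrow> int" where
  "class_dims k X = dims k (SOME x. x \<in> X)"

lemma class_dims_iso_class: "x \<in> fam_obj k \<Longrightarrow> class_dims k (iso_class (A_inf k) x) = dims k x"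
  unfolding class_dims_def using someI[of "\<lambda>y. y \<in> iso_class (A_inf k) x" x] by (simp add: iso_class_eq)

lemma iso_semiring_simps:
  "carrier (iso_semiring (A_inf k)) = iso_class (A_inf k) ` fam_obj k"
  "\<one>\<^bsub>iso_semiring (A_inf k)\<^esub> = iso_class (A_inf k) (fam_unit k)"
  by (simp_all add: iso_semiring_def A_inf_simps)

lemma iso_semiring_zero: "\<zero>\<^bsub>iso_semiring (A_inf k)\<^esub> = {z \<in> fam_obj k. dims k z = (\<lambda>a. 0)}"
  by (auto simp: iso_semiring_def A_inf_simps is_zero_obj_iff_dims)

text \<open>Only a level set of \<open>dims\<close> is obtained at this point; that it is again an
  isomorphism class needs a member, which comes from realising the series by coordinate
  spaces.\<close>

lemma iso_semiring_add:
  assumes x: "x \<in> fam_obj k" and y: "y \<in> fam_obj k"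
  shows "iso_class (A_inf k) x \<oplus>\<^bsub>iso_semiring (A_inf k)\<^esub> iso_class (A_inf k) y =
    {z \<in> fam_obj k. dims k z = (\<lambda>a. dims k x a + dims k y a)}"
proof -
  have "(\<exists>x'\<in>iso_class (A_inf k) x. \<exists>y'\<in>iso_class (A_inf k) y. is_biproduct (A_inf k) x' y' z) \<longleftrightarrow>
      dims k z = (\<lambda>a. dims k x a + dims k y a)" if "z \<in> fam_obj k" for z
    using x y that by (auto simp: iso_class_eq is_biproduct_iff_dims)
  then show ?thesis by (auto simp: iso_semiring_def A_inf_simps)
qed

lemma iso_semiring_mult:
  assumes k: "field k" and x: "x \<in> fam_obj k" and y: "y \<in> fam_obj k"
  shows "iso_class (A_inf k) x \<otimes>\<^bsub>iso_semiring (A_inf k)\<^esub> iso_class (A_inf k) y =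
    {z \<in> fam_obj k. dims k z = conv (dims k x) (dims k y)}"
proof -
  have "(\<exists>x'\<in>iso_class (A_inf k) x. \<exists>y'\<in>iso_class (A_inf k) y. iso_obj (A_inf k) (fam_tens k x' y') z) \<longleftrightarrow>
      dims k z = conv (dims k x) (dims k y)" if "z \<in> fam_obj k" for z
    using x y that by (auto simp: iso_class_eq iso_obj_iff_dims fam_tens_obj[OF k] dims_fam_tens[OF k])
  then show ?thesis by (auto simp: iso_semiring_def A_inf_simps)
qed

text \<open>A level set of \<open>dims\<close> is an isomorphism class once it is inhabited, as it
  is for nonnegative series. Closure of the semiring under zero, sum and product rests on
  this.\<close>

lemma dims_class_eq_iso_class:
  assumes k: "field k" and f: "f \<in> carrier bounded_series_ring" "\<And>a. f a \<ge> 0"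
  obtains x where "x \<in> fam_obj k" "dims k x = f" "{z \<in> fam_obj k. dims k z = f} = iso_class (A_inf k) x"
proof -
  obtain x where "x \<in> fam_obj k" "dims k x = f"
    by (rule fam_obj_exists[OF assms])
  then show ?thesis
    by (intro that[of x]) (simp_all add: iso_class_eq)
qed

lemma bounded_series_diff:
  assumes "f \<in> carrier bounded_series_ring" "g \<in> carrier bounded_series_ring"
  shows "f \<ominus>\<^bsub>bounded_series_ring\<^esub> g = (\<lambda>a. f a - g a)"
proof -
  interpret ring bounded_series_ring by (rule ring_bounded_series)
  have "(\<lambda>a. - g a) \<in> carrier bounded_series_ring"
    using assms(2) by (simp add: bounded_series_iff)
  then have "\<ominus>\<^bsub>bounded_series_ring\<^esub> g = (\<lambda>a. - g a)"
    using assms(2) by (intro minus_equality) (auto simp: bounded_series_ring_simps(4,5))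
  then show ?thesis by (simp add: a_minus_def bounded_series_ring_simps(5))
qed

text \<open>The positive and negative parts vanish wherever \<open>f\<close> does, so they obey the
  same degree bound.\<close>

lemma bounded_series_parts:
  assumes "f \<in> carrier bounded_series_ring"
  shows "(\<lambda>a. max (f a) 0) \<in> carrier bounded_series_ring" "(\<lambda>a. max (- f a) 0) \<in> carrier bounded_series_ring"
    "f = (\<lambda>a. max (f a) 0) \<ominus>\<^bsub>bounded_series_ring\<^esub> (\<lambda>a. max (- f a) 0)"
proof -
  obtain d where d: "\<And>a. f a \<noteq> 0 \<Longrightarrow> total a \<le> d"
    using assms by (auto simp: bounded_series_iff)
  have "max (f a) 0 \<noteq> 0 \<Longrightarrow> f a \<noteq> 0" "max (- f a) 0 \<noteq> 0 \<Longrightarrow> f a \<noteq> 0" for a by auto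
  with d show *: "(\<lambda>a. max (f a) 0) \<in> carrier bounded_series_ring" "(\<lambda>a. max (- f a) 0) \<in> carrier bounded_series_ring"
    unfolding bounded_series_iff by blast+
  show "f = (\<lambda>a. max (f a) 0) \<ominus>\<^bsub>bounded_series_ring\<^esub> (\<lambda>a. max (- f a) 0)"
    by (auto simp: bounded_series_diff[OF *] fun_eq_iff)
qed

lemma difference_ring_iso_semiring:
  assumes k: "field k"
  shows "difference_ring (iso_semiring (A_inf k)) bounded_series_ring (class_dims k)"
proof (intro difference_ring.intro difference_ring_axioms.intro ring_bounded_series)
  let ?S = "iso_semiring (A_inf k)" and ?c = "iso_class (A_inf k)"
  have nonneg: "conv (dims k x) (dims k y) a \<ge> 0" for x y a
    by (auto simp: conv_def dims_def intro!: sum_nonneg)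
  \<comment> \<open>For zero, sums and products alike, an object with the expected series is
    exhibited. This shows at once that the result is a class and what its series is.\<close>
  have zero: "\<exists>z\<in>fam_obj k. dims k z = (\<lambda>a. 0) \<and> \<zero>\<^bsub>?S\<^esub> = ?c z"
    by (rule dims_class_eq_iso_class[OF k, of "\<lambda>a. 0"]) (auto simp: bounded_series_iff iso_semiring_zero)
  have add: "\<exists>z\<in>fam_obj k. dims k z = (\<lambda>a. dims k x a + dims k y a) \<and> ?c x \<oplus>\<^bsub>?S\<^esub> ?c y = ?c z"
    if xy: "x \<in> fam_obj k" "y \<in> fam_obj k" for x y
    by (rule dims_class_eq_iso_class[OF k bounded_series_add[OF xy[THEN dims_bounded]]])
      (auto simp: dims_def iso_semiring_add[OF xy])
  have mult: "\<exists>z\<in>fam_obj k. dims k z = conv (dims k x) (dims k y) \<and> ?c x \<otimes>\<^bsub>?S\<^esub> ?c y = ?c z"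
    if xy: "x \<in> fam_obj k" "y \<in> fam_obj k" for x y
    by (rule dims_class_eq_iso_class[OF k bounded_series_conv[OF xy[THEN dims_bounded]] nonneg])
      (auto simp: iso_semiring_mult[OF k xy])
  show "\<zero>\<^bsub>?S\<^esub> \<in> carrier ?S" "class_dims k \<zero>\<^bsub>?S\<^esub> = \<zero>\<^bsub>bounded_series_ring\<^esub>"
    using zero by (auto simp: iso_semiring_simps class_dims_iso_class bounded_series_ring_simps(4))
  show "\<one>\<^bsub>?S\<^esub> \<in> carrier ?S" "class_dims k \<one>\<^bsub>?S\<^esub> = \<one>\<^bsub>bounded_series_ring\<^esub>"
    using fam_unit_obj[OF k]
    by (simp_all add: iso_semiring_simps class_dims_iso_class dims_fam_unit[OF k] bounded_series_ring_simps(3))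
  show "inj_on (class_dims k) (carrier ?S)"
  proof (rule inj_onI)
    fix X Y assume "X \<in> carrier ?S" "Y \<in> carrier ?S" and eq: "class_dims k X = class_dims k Y"
    then obtain x y where xy: "x \<in> fam_obj k" "X = ?c x" "y \<in> fam_obj k" "Y = ?c y"
      by (auto simp: iso_semiring_simps)
    with eq have "dims k x = dims k y" by (simp add: class_dims_iso_class)
    with xy show "X = Y" by (simp add: iso_class_eq)
  qed
  show "class_dims k X \<in> carrier bounded_series_ring" if "X \<in> carrier ?S" for X
    using that by (auto simp: iso_semiring_simps class_dims_iso_class dims_bounded)
  fix X Y assume "X \<in> carrier ?S" "Y \<in> carrier ?S"
  then obtain x y where xy: "x \<in> fam_obj k" "X = ?c x" "y \<in> fam_obj k" "Y = ?c y"
    by (auto simp: iso_semiring_simps)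
  show "X \<oplus>\<^bsub>?S\<^esub> Y \<in> carrier ?S" "class_dims k (X \<oplus>\<^bsub>?S\<^esub> Y) = class_dims k X \<oplus>\<^bsub>bounded_series_ring\<^esub> class_dims k Y"
    using add[OF xy(1,3)] xy
    by (auto simp: iso_semiring_simps class_dims_iso_class bounded_series_ring_simps(5))
  show "X \<otimes>\<^bsub>?S\<^esub> Y \<in> carrier ?S" "class_dims k (X \<otimes>\<^bsub>?S\<^esub> Y) = class_dims k X \<otimes>\<^bsub>bounded_series_ring\<^esub> class_dims k Y"
    using mult[OF xy(1,3)] xy
    by (auto simp: iso_semiring_simps class_dims_iso_class bounded_series_ring_simps(2))
next
  let ?S = "iso_semiring (A_inf k)" and ?c = "iso_class (A_inf k)"
  fix f assume f: "f \<in> carrier bounded_series_ring"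
  obtain x where x: "x \<in> fam_obj k" "dims k x = (\<lambda>a. max (f a) 0)"
    by (rule fam_obj_exists[OF k bounded_series_parts(1)[OF f]]) auto
  obtain y where y: "y \<in> fam_obj k" "dims k y = (\<lambda>a. max (- f a) 0)"
    by (rule fam_obj_exists[OF k bounded_series_parts(2)[OF f]]) auto
  have "f = class_dims k (?c x) \<ominus>\<^bsub>bounded_series_ring\<^esub> class_dims k (?c y)"
    using bounded_series_parts(3)[OF f] x y by (simp add: class_dims_iso_class)
  then show "\<exists>X\<in>carrier ?S. \<exists>Y\<in>carrier ?S. f = class_dims k X \<ominus>\<^bsub>bounded_series_ring\<^esub> class_dims k Y"
    using x(1) y(1) by (auto simp: iso_semiring_simps)
qed

theorem theorem15p1:
  fixes k :: "('a, 'b) ring_scheme"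
  assumes "field k"
    and "\<And>n::nat. n \<noteq> 0 \<Longrightarrow> [n] \<cdot>\<^bsub>k\<^esub> \<one>\<^bsub>k\<^esub> \<noteq> \<zero>\<^bsub>k\<^esub>"
  shows "graded_ring (groth_ring (A_inf k)) (groth_grade (A_inf k)) \<and>
         graded_ring bounded_series_ring homogeneous_series \<and>
         graded_ring_iso (groth_ring (A_inf k)) (groth_grade (A_inf k))
           bounded_series_ring homogeneous_series \<noteq> {}"
proof -
  let ?S = "iso_semiring (A_inf k)" and ?c = "iso_class (A_inf k)"
  interpret difference_ring ?S bounded_series_ring "class_dims k"
    by (rule difference_ring_iso_semiring[OF assms(1)])
  have iso: "fibre \<in> ring_iso bounded_series_ring (groth_ring (A_inf k))"
    using fibre_iso by (simp add: groth_ring_def)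
  have diff_class: "diff_class ?S (?c x) (?c y) = fibre (\<lambda>a. dims k x a - dims k y a)"
    if "x \<in> fam_obj k" "y \<in> fam_obj k" for x y
    using that
    by (simp add: diff_class_eq iso_semiring_simps class_dims_iso_class bounded_series_diff dims_bounded)
  \<comment> \<open>Differences of homogeneous series of degree \<open>m\<close> are homogeneous of
    degree \<open>m\<close>. Conversely, the positive and negative parts of such a series are
    supported in the same degree, so both are realised by objects of that grade.\<close>
  have grade: "groth_grade (A_inf k) m = fibre ` homogeneous_series m" for m
  proof
    show "groth_grade (A_inf k) m \<subseteq> fibre ` homogeneous_series m"
    proof
      fix P assume "P \<in> groth_grade (A_inf k) m"
      then obtain x y where xy: "x \<in> fam_grade k m" "y \<in> fam_grade k m" "P = diff_class ?S (?c x) (?c y)"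
        by (auto simp: groth_grade_def A_inf_simps)
      then have "P = fibre (\<lambda>a. dims k x a - dims k y a)"
        by (simp add: fam_grade_iff diff_class)
      moreover have "(\<lambda>a. dims k x a - dims k y a) \<in> homogeneous_series m"
        using xy by (force simp: fam_grade_iff homogeneous_series_def)
      ultimately show "P \<in> fibre ` homogeneous_series m" by blast
    qed
    show "fibre ` homogeneous_series m \<subseteq> groth_grade (A_inf k) m"
    proof (rule image_subsetI)
      fix f assume f: "f \<in> homogeneous_series m"
      then have f': "f \<in> carrier bounded_series_ring" using homogeneous_subset by blast
      obtain x where x: "x \<in> fam_obj k" "dims k x = (\<lambda>a. max (f a) 0)"
        by (rule fam_obj_exists[OF assms(1) bounded_series_parts(1)[OF f']]) auto
      obtain y where y: "y \<in> fam_obj k" "dims k y = (\<lambda>a. max (- f a) 0)"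
        by (rule fam_obj_exists[OF assms(1) bounded_series_parts(2)[OF f']]) auto
      have "x \<in> fam_grade k m" "y \<in> fam_grade k m"
        using x y f by (auto simp: fam_grade_iff homogeneous_series_def max_def split: if_splits)
      moreover have "(\<lambda>a. dims k x a - dims k y a) = f"
        by (auto simp: x y)
      then have "fibre f = diff_class ?S (?c x) (?c y)"
        using diff_class[OF x(1) y(1)] by simp
      ultimately show "fibre f \<in> groth_grade (A_inf k) m"
        by (auto simp: groth_grade_def A_inf_simps)
    qed
  qed
  have "graded_ring (groth_ring (A_inf k)) (\<lambda>m. fibre ` homogeneous_series m)"
    by (rule graded_ring_iso_image[OF graded_ring_bounded_series _ iso])
      (simp add: groth_ring_def ring_group_completion)
  \<comment> \<open>\<open>fibre\<close> runs from series to classes of pairs, whereas the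
    isomorphism asked for goes the other way.\<close>
  moreover have "inv_into (carrier bounded_series_ring) fibre \<in>
      graded_ring_iso (groth_ring (A_inf k)) (groth_grade (A_inf k)) bounded_series_ring homogeneous_series"
  proof -
    have "inv_into (carrier bounded_series_ring) fibre \<in> ring_iso (groth_ring (A_inf k)) bounded_series_ring"
      by (rule ring_iso_set_sym[OF ring_bounded_series iso])
    moreover have "inj_on fibre (carrier bounded_series_ring)"
      using iso by (auto simp: ring_iso_def bij_betw_def)
    ultimately show ?thesis
      using homogeneous_subset
      by (simp add: graded_ring_iso_def grade inv_into_image_cancel)
  qed
  ultimately show ?thesis
    using graded_ring_bounded_series grade[abs_def] by (auto simp: fun_eq_iff)
qed

end
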